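(* Let $d\ge 2$ and $a>0$. Let $E\subset\mathbb{R}^d$ be a closed set that has a unique diameter of length $2a$ between the poles $(-a,\mathbf 0)$ and $(a,\mathbf 0)$, has smooth pole caps with boundary functions $s^\ell,s^r$, and satisfies the curvature condition for some $\eta\in(0,1)$ (all as defined in the context). Let $f:E\to[0,\infty)$ satisfy $\int_E f(z)\,\mathrm dz=1$, be continuous at the poles $(-a,\mathbf 0)$ and $(a,\mathbf 0)$, with $p_\ell:=f(-a,\mathbf 0)>0$ and $p_r:=f(a,\mathbf 0)>0$. Let $Z_1,Z_2,\ldots$ be i.i.d. random vectors with Lebesgue density $f$ on $E$, for each $n\in\mathbb N$ let $N_n$ be a Poisson random variable with mean $n$ independent of $(Z_i)_{i\ge1}$, and put $\mathrm{diam}(\mathbf Z_n):=\max_{1\le i,j\le N_n}|Z_i-Z_j|$ and $M_n:=\max_{1\le i,j\le n}|Z_i-Z_j|$. Then, as $n\to\infty$, $$n^{\frac{2}{d+1}}\big(2a-\mathrm{diam}(\mathbf Z_n)\big)\ \overset{\mathcal D}{\longrightarrow}\ \min_{i,j\ge1}\Big\{\mathcal X_{i,1}+\mathcal Y_{j,1}-\frac1{4a}\big|\widetilde{\mathcal X}_i-\widetilde{\mathcal Y}_j\big|^2\Big\},$$ where $\{\mathcal X_i,i\ge1\}$ and $\{\mathcal Y_j,j\ge1\}$ are independent Poisson processes on $\mathbb R^d$ with intensity measures $p_\ell\cdot m_d|_{P(H_\ell)}$ and $p_r\cdot m_d|_{P(H_r)}$, respectively. The same holds true if $\mathrm{diam}(\mathbf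 Z_n)$ is replaced with $M_n$.
   Context: Notation: $|\cdot|$ is the Euclidean norm, $m_d$ is Lebesgue measure on $\mathbb R^d$, $\mu|_A(B):=\mu(A\cap B)$, $\widetilde z:=(z_2,\ldots,z_d)$ for $z=(z_1,\ldots,z_d)\in\mathbb R^d$, and $\mathcal X_i=(\mathcal X_{i,1},\widetilde{\mathcal X}_i)$, $\mathcal Y_j=(\mathcal Y_{j,1},\widetilde{\mathcal Y}_j)$. A maximum over an empty set is $0$ (this convention is immaterial). Unique diameter: $E\subset\mathbb R^d$ is closed, $0<2a=\mathrm{diam}(E)<\infty$, $(-a,\mathbf 0),(a,\mathbf 0)\in E$, and $|x-y|<2a$ for each $(x,y)\in(E\setminus\{(-a,\mathbf 0),(a,\mathbf 0)\})\times E$. Smooth pole caps: there are constants $\delta_\ell,\delta_r\in(0,a]$, open neighborhoods $O_\ell,O_r\subset\mathbb R^{d-1}$ of $\mathbf 0$ and twice continuously differentiable functions $s^\ell:O_\ell\to[0,\infty)$, $s^r:O_r\to[0,\infty)$ with $E_\ell:=E\cap\{z_1<-a+\delta_\ell\}=\{(z_1,\widetilde z):-a+s^\ell(\widetilde z)\le z_1<-a+\delta_\ell,\ \widetilde z\in O_\ell\}$ and $E_r:=E\cap\{a-\delta_r<z_1\}=\{(z_1,\widetilde z):a-\delta_r<z_1\le a-s^r(\widetilde z),\ \widetilde z\in O_r\}$. For $i\in\{\ell,r\}$, $H_i$ denotes the Hessian of $s^i$ at $\mathbf 0$ (a symmetric positive definite matrix in this setting), $\kappa_2^i\le\ldots\le\kappa_d^i$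 its eigenvalues, $D_i:=\mathrm{diag}(\kappa_2^i,\ldots,\kappa_d^i)$, and $U_i$ an orthogonal $(d-1)\times(d-1)$ matrix whose columns are corresponding orthonormal eigenvectors, so $U_i^\top H_iU_i=D_i$. Curvature condition for $\eta\in(0,1)$: the matrix $$A(\eta):=\begin{pmatrix} 2a\eta D_\ell-\mathrm I_{d-1} & U_\ell^\top U_r \\ U_r^\top U_\ell & 2a\eta D_r-\mathrm I_{d-1} \end{pmatrix}$$ is positive semi-definite. For a $(d-1)\times(d-1)$ matrix $H$: $P(H):=\{(z_1,\widetilde z)\in\mathbb R^d:\frac12\widetilde z^\top H\widetilde z\le z_1\}$. *)

theory Defs
  imports "HOL-Probability.Probability"
begin

text \<open>
  Points of \<open>\<real>\<^sup>d\<close> are written \<open>(z\<^sub>1, w)\<close> of type \<^typ>\<open>real \<times> (real^'n)\<close>, so that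
  \<open>d = CARD('n) + 1 = DIM(real \<times> (real^'n))\<close>, \<open>d \<ge> 2\<close> holds automatically, and \<open>w = snd z\<close> is
  the vector of the last \<open>d - 1\<close> coordinates. The norm of the product type is the Euclidean norm.
\<close>

subsection \<open>Geometry of the set\<close>

definition unique_diameter :: "real \<Rightarrow> (real \<times> (real^'n)) set \<Rightarrow> bool" where
  "unique_diameter a E \<longleftrightarrow>
     closed E \<and> bounded E \<and> 0 < 2 * a \<and> diameter E = 2 * a \<and>
     (-a, 0) \<in> E \<and> (a, 0) \<in> E \<and>
     (\<forall>(x, y) \<in> (E - {(-a, 0), (a, 0)}) \<times> E. norm (x - y) < 2 * a)"

definition partial_deriv :: "'n \<Rightarrow> (real^'n \<Rightarrow> real) \<Rightarrow> real^'n \<Rightarrow> real" where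
  "partial_deriv i s x = frechet_derivative s (at x) (axis i 1)"

definition hessian :: "(real^'n \<Rightarrow> real) \<Rightarrow> real^'n \<Rightarrow> real^'n^'n" where
  "hessian s x = (\<chi> i j. partial_deriv i (partial_deriv j s) x)"

text \<open>Only meaningful for open \<open>S\<close>.\<close>

definition twice_continuously_differentiable_on ::
    "(real^'n \<Rightarrow> real) \<Rightarrow> (real^'n) set \<Rightarrow> bool" where
  "twice_continuously_differentiable_on s S \<longleftrightarrow>
     (\<forall>x\<in>S. s differentiable (at x)) \<and>
     (\<forall>i. \<forall>x\<in>S. partial_deriv i s differentiable (at x)) \<and>
     continuous_on S (hessian s)"

definition cap_function :: "(real^'n) set \<Rightarrow> (real^'n \<Rightarrow> real) \<Rightarrow> bool" where
  "cap_function S s \<longleftrightarrow>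
     open S \<and> 0 \<in> S \<and> (\<forall>w\<in>S. 0 \<le> s w) \<and> twice_continuously_differentiable_on s S"

definition smooth_pole_caps ::
    "real \<Rightarrow> (real \<times> (real^'n)) set \<Rightarrow> (real^'n \<Rightarrow> real) \<Rightarrow> (real^'n \<Rightarrow> real) \<Rightarrow> bool" where
  "smooth_pole_caps a E sl sr \<longleftrightarrow>
     (\<exists>\<delta>l \<delta>r Ol Or. \<delta>l \<in> {0<..a} \<and> \<delta>r \<in> {0<..a} \<and> cap_function Ol sl \<and> cap_function Or sr \<and>
        E \<inter> {z. fst z < -a + \<delta>l} = {(z1, w). -a + sl w \<le> z1 \<and> z1 < -a + \<delta>l \<and> w \<in> Ol} \<and>
        E \<inter> {z. a - \<delta>r < fst z} = {(z1, w). a - \<delta>r < z1 \<and> z1 \<le> a - sr w \<and> w \<in> Or})"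

subsection \<open>The curvature condition\<close>

definition diag_matrix :: "('n \<Rightarrow> real) \<Rightarrow> real^'n^'n" where
  "diag_matrix \<kappa> = (\<chi> i j. if i = j then \<kappa> i else 0)"

text \<open>
  The index type carries no order, so \<open>\<kappa>\<close> is not required to be monotone: listing the
  eigenvalues in increasing order is a choice of enumeration of the indices, which permutes the
  columns of \<open>U\<close> and the entries of \<open>\<kappa>\<close> simultaneously.
\<close>

definition orthonormal_eigenbasis :: "real^'n^'n \<Rightarrow> ('n \<Rightarrow> real) \<Rightarrow> real^'n^'n \<Rightarrow> bool" where
  "orthonormal_eigenbasis H \<kappa> U \<longleftrightarrow>
     orthogonal_matrix U \<and> (\<forall>i. H *v column i U = \<kappa> i *\<^sub>R column i U)"

definition block_matrix ::
    "real^'n^'n \<Rightarrow> real^'n^'n \<Rightarrow> real^'n^'n \<Rightarrow> real^'n^'n \<Rightarrow> real^('n + 'n)^('n + 'n)" where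
  "block_matrix A B C D = (\<chi> i j.
     case i of
       Inl k \<Rightarrow> (case j of Inl l \<Rightarrow> A $ k $ l | Inr l \<Rightarrow> B $ k $ l)
     | Inr k \<Rightarrow> (case j of Inl l \<Rightarrow> C $ k $ l | Inr l \<Rightarrow> D $ k $ l))"

definition positive_semidefinite :: "real^'m^'m \<Rightarrow> bool" where
  "positive_semidefinite A \<longleftrightarrow> transpose A = A \<and> (\<forall>v. 0 \<le> v \<bullet> (A *v v))"

definition curvature_matrix ::
    "real \<Rightarrow> ('n \<Rightarrow> real) \<Rightarrow> real^'n^'n \<Rightarrow> ('n \<Rightarrow> real) \<Rightarrow> real^'n^'n \<Rightarrow> real \<Rightarrow> real^('n + 'n)^('n + 'n)"
  where
  "curvature_matrix a \<kappa>l Ul \<kappa>r Ur \<eta> =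
     block_matrix
       ((2 * a * \<eta>) *\<^sub>R diag_matrix \<kappa>l - mat 1)  (transpose Ul ** Ur)
       (transpose Ur ** Ul)                     ((2 * a * \<eta>) *\<^sub>R diag_matrix \<kappa>r - mat 1)"

definition paraboloid :: "real^'n^'n \<Rightarrow> (real \<times> (real^'n)) set" where
  "paraboloid H = {(z1, w). (1/2) * (w \<bullet> (H *v w)) \<le> z1}"

subsection \<open>Sample diameter\<close>

text \<open>The first \<open>m\<close> sample points are \<open>z 0, \<dots>, z (m - 1)\<close>.\<close>

definition max_dist :: "(nat \<Rightarrow> 'a::real_normed_vector) \<Rightarrow> nat \<Rightarrow> real" where
  "max_dist z m = (if m = 0 then 0 else Max {norm (z i - z j) | i j. i < m \<and> j < m})"

subsection \<open>Poisson processes\<close>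

text \<open>The Poisson law with mean in \<open>[0, \<infinity>]\<close>; \<^const>\<open>poisson_pmf\<close> requires a positive mean.\<close>

definition poisson_law :: "ennreal \<Rightarrow> ennreal measure" where
  "poisson_law m =
     (if m = 0 then return borel 0
      else if m = \<infinity> then return borel \<infinity>
      else distr (measure_pmf (poisson_pmf (enn2real m))) borel of_nat)"

text \<open>The number of indices \<open>i\<close> with \<open>X i \<omega> \<in> B\<close>, possibly infinite.\<close>

definition point_count :: "(nat \<Rightarrow> 'w \<Rightarrow> 'a) \<Rightarrow> 'a set \<Rightarrow> 'w \<Rightarrow> ennreal" where
  "point_count X B \<omega> = emeasure (count_space UNIV) {i. X i \<omega> \<in> B}"

text \<open>
  The random variables \<open>X 0, X 1, \<dots>\<close> enumerate (with multiplicity) the points of a Poisson process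
  with intensity measure \<open>\<mu>\<close>. As every index carries a point, this is only suitable for
  \<open>\<mu>\<close> of infinite total mass.
\<close>

definition poisson_process :: "'w measure \<Rightarrow> 'a measure \<Rightarrow> (nat \<Rightarrow> 'w \<Rightarrow> 'a) \<Rightarrow> bool" where
  "poisson_process M \<mu> X \<longleftrightarrow>
     (\<forall>i. X i \<in> measurable M \<mu>) \<and>
     (\<forall>B\<in>sets \<mu>. distr M borel (point_count X B) = poisson_law (emeasure \<mu> B)) \<and>
     (\<forall>(k::nat) B. (\<forall>i<k. B i \<in> sets \<mu>) \<longrightarrow> disjoint_family_on B {..<k} \<longrightarrow>
        prob_space.indep_vars M (\<lambda>_. borel) (\<lambda>i. point_count X (B i)) {..<k})"

text \<open>
  Independence of two point processes, as random counting measures: the ordering of the points in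
  the two enumerations is irrelevant.
\<close>

definition indep_processes ::
    "'w measure \<Rightarrow> (nat \<Rightarrow> 'w \<Rightarrow> 'a::topological_space) \<Rightarrow> (nat \<Rightarrow> 'w \<Rightarrow> 'a) \<Rightarrow> bool" where
  "indep_processes M X Y \<longleftrightarrow>
     prob_space.indep_var M
       (Pi\<^sub>M (sets borel) (\<lambda>_. borel)) (\<lambda>\<omega>. \<lambda>B\<in>sets borel. point_count X B \<omega>)
       (Pi\<^sub>M (sets borel) (\<lambda>_. borel)) (\<lambda>\<omega>. \<lambda>B\<in>sets borel. point_count Y B \<omega>)"

definition paraboloid_intensity :: "real \<Rightarrow> real^'n^'n \<Rightarrow> (real \<times> (real^'n)) measure" where
  "paraboloid_intensity p H = density lborel (\<lambda>z. ennreal p * indicator (paraboloid H) z)"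

definition pair_value :: "real \<Rightarrow> real \<times> (real^'n) \<Rightarrow> real \<times> (real^'n) \<Rightarrow> real" where
  "pair_value a x y = fst x + fst y - 1 / (4 * a) * (norm (snd x - snd y))\<^sup>2"

end

theory Submission
  imports Defs
begin

text \<open>
  Near the poles, in coordinates scaled by \<open>n powr (2 / (d + 1))\<close> along the axis and by its square
  root across, the deficit \<open>2 * a - norm (x - y)\<close> becomes \<open>pair_value\<close>, uniformly on bounded windows.
  As \<open>\<eta> < 1\<close>, pairs with bounded scaled deficit must lie in a fixed bounded window, both for the
  sample and for the limiting processes. It then suffices to know which of finitely many small balls
  covering the windows are hit. The law of this random set is determined by the probabilities of
  avoiding unions of balls, which are \<open>(1 - q) ^ n\<close> or \<open>exp (- n * q)\<close> for the sample and
  exponentials of the intensity measures in the limit; so only the convergence of \<open>n * q\<close> to the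
  intensity is needed.
\<close>

subsection \<open>Local geometry and the curvature condition\<close>

text \<open>A cap of height \<rho>^2 has width of order \<rho>, hence volume of order \<rho>^(d+1);
  equating this with 1/n leaves a bounded expected number of points in a scaled window. For a pair
  with total scaled height s and squared scaled transversal distance q, the distance L satisfies L^2
  = (2a - \<rho>^2 s)^2 + \<rho>^2 q. Dividing 4a^2 - L^2 by 2a + L, which is close to 4a, gives s -
  q/(4a) to leading order, hence \<open>pair_value\<close>. The obstacle is the negative term: a
  pair of high points might do as well as a pair of low ones, and an infimum over infinitely many
  pairs is not stable under local convergence. The curvature condition gives q \<le> 4a\<eta>s up to
  Taylor errors, so the deficit is at least a positive multiple of s. The sample size enters only
  through one statement on avoidance probabilities, so the case of fixed size is handled directly
  instead of being deduced from the Poisson case. Cells of positive size cost a small shift of the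
  level t, which is harmless at continuity points of the limit law.\<close>

lemma frechet_eq_sum_partial_deriv:
  fixes s :: "real^'n \<Rightarrow> real"
  assumes "s differentiable (at x)"
  shows "frechet_derivative s (at x) w = (\<Sum>i\<in>UNIV. w $ i * partial_deriv i s x)"
proof -
  have lin: "linear (frechet_derivative s (at x))"
    using assms linear_frechet_derivative by blast
  have "frechet_derivative s (at x) w = frechet_derivative s (at x) (\<Sum>i\<in>UNIV. w $ i *\<^sub>R axis i 1)"
    by (simp add: basis_expansion scalar_mult_eq_scaleR[symmetric])
  also have "\<dots> = (\<Sum>i\<in>UNIV. w $ i * partial_deriv i s x)"
    by (simp add: linear_sum[OF lin] linear_cmul[OF lin] partial_deriv_def)
  finally show ?thesis .
qed

text \<open>A Taylor expansion whose error is uniform over directions. As \<open>s\<close> is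
  nonnegative and \<open>s 0 = 0\<close>, the origin is a minimum and the gradient vanishes there.
  The gradient is then linear up to a small multiple of the distance, and the mean value theorem
  along the segment from 0 to \<open>w\<close> carries this over to \<open>s\<close>.\<close>

lemma cap_function_quadratic_approx:
  fixes s :: "real^'n \<Rightarrow> real"
  assumes cap: "cap_function S s" and s0: "s 0 = 0" and e: "e > 0"
  obtains r where "r > 0"
    "\<And>w. norm w < r \<Longrightarrow> w \<in> S \<and> \<bar>s w - (w \<bullet> (hessian s 0 *v w)) / 2\<bar> \<le> e * (norm w)\<^sup>2"
proof -
  let ?H = "hessian s 0"
  have S: "open S" "0 \<in> S" and snn: "\<And>w. w \<in> S \<Longrightarrow> 0 \<le> s w"
    and d1: "\<And>x. x \<in> S \<Longrightarrow> s differentiable (at x)"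
    and d2: "\<And>i x. x \<in> S \<Longrightarrow> partial_deriv i s differentiable (at x)"
    using cap by (auto simp: cap_function_def twice_continuously_differentiable_on_def)
  have "(s has_derivative frechet_derivative s (at 0)) (at 0)"
    using d1[OF S(2)] frechet_derivative_works by blast
  then have "frechet_derivative s (at 0) = (\<lambda>v. 0)"
    using differential_zero_maxmin[OF S(2,1), of s] snn s0 by auto
  then have grad0: "partial_deriv i s 0 = 0" for i
    by (simp add: partial_deriv_def)
  \<comment> \<open>The errors of the partial derivatives are added up over all coordinates in
    \<open>bound\<close>, hence the division.\<close>
  define e' where "e' = e / real CARD('n)"
  have e': "e' > 0" using e by (simp add: e'_def)
  have "\<exists>d>0. \<forall>x. norm x < d \<longrightarrow> \<bar>partial_deriv j s x - (\<Sum>i\<in>UNIV. x $ i * ?H $ i $ j)\<bar> \<le> e' * norm x" for j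
  proof -
    have "(partial_deriv j s has_derivative frechet_derivative (partial_deriv j s) (at 0)) (at 0)"
      using d2[OF S(2)] frechet_derivative_works by blast
    then obtain d where "d > 0" and d: "\<And>y. norm y < d \<Longrightarrow>
        norm (partial_deriv j s y - partial_deriv j s 0 - frechet_derivative (partial_deriv j s) (at 0) y) \<le> e' * norm y"
      using e' unfolding has_derivative_at_alt by (metis diff_zero)
    have "frechet_derivative (partial_deriv j s) (at 0) y = (\<Sum>i\<in>UNIV. y $ i * ?H $ i $ j)" for y
      using frechet_eq_sum_partial_deriv[OF d2[OF S(2)], of j y] by (simp add: hessian_def)
    with d \<open>d > 0\<close> grad0 show ?thesis by (intro exI[of _ d]) auto
  qed
  then obtain dd where dd: "\<And>j. dd j > 0"
    and ddb: "\<And>j x. norm x < dd j \<Longrightarrow> \<bar>partial_deriv j s x - (\<Sum>i\<in>UNIV. x $ i * ?H $ i $ j)\<bar> \<le> e' * norm x"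
    by metis
  obtain r0 where r0: "r0 > 0" "ball 0 r0 \<subseteq> S"
    using S open_contains_ball by blast
  define r where "r = min r0 (Min (range dd))"
  have r: "r > 0" "r \<le> r0" "\<And>j. r \<le> dd j"
    using r0 dd by (auto simp: r_def min.coboundedI2)
  have bound: "\<bar>frechet_derivative s (at x) w - (\<Sum>j\<in>UNIV. w $ j * (\<Sum>i\<in>UNIV. x $ i * ?H $ i $ j))\<bar> \<le> e * norm w * norm x"
    if x: "norm x < r" for x w
  proof -
    have "x \<in> S" using x r r0 by auto
    then have "frechet_derivative s (at x) w - (\<Sum>j\<in>UNIV. w $ j * (\<Sum>i\<in>UNIV. x $ i * ?H $ i $ j))
      = (\<Sum>j\<in>UNIV. w $ j * (partial_deriv j s x - (\<Sum>i\<in>UNIV. x $ i * ?H $ i $ j)))"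
      by (simp add: frechet_eq_sum_partial_deriv d1 sum_subtractf right_diff_distrib)
    also have "\<bar>\<dots>\<bar> \<le> (\<Sum>j\<in>(UNIV::'n set). norm w * (e' * norm x))"
    proof (rule order_trans[OF sum_abs], rule sum_mono)
      fix j :: 'n
      have "\<bar>w $ j\<bar> \<le> norm w" by (rule component_le_norm_cart)
      moreover have "\<bar>partial_deriv j s x - (\<Sum>i\<in>UNIV. x $ i * ?H $ i $ j)\<bar> \<le> e' * norm x"
        using ddb x r(3) by (meson less_le_trans)
      ultimately show "\<bar>w $ j * (partial_deriv j s x - (\<Sum>i\<in>UNIV. x $ i * ?H $ i $ j))\<bar> \<le> norm w * (e' * norm x)"
        unfolding abs_mult by (intro mult_mono) auto
    qed
    also have "\<dots> = e * norm w * norm x" by (simp add: e'_def)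
    finally show ?thesis .
  qed
  show thesis
  proof (rule that[OF r(1)])
    fix w :: "real^'n" assume w: "norm w < r"
    define Q where "Q = w \<bullet> (?H *v w)"
    have Q: "Q = (\<Sum>j\<in>UNIV. w $ j * (\<Sum>i\<in>UNIV. w $ i * ?H $ i $ j))"
      unfolding Q_def inner_vec_def matrix_vector_mult_def
      by (simp add: sum_distrib_left mult_ac, subst sum.swap) (simp add: mult_ac)
    \<comment> \<open>Subtracting the quadratic term makes the derivative of \<phi> at
      \<open>t\<close> the gradient error at \<open>t *\<^sub>R w\<close> in direction
      \<open>w\<close>, which \<open>bound\<close> controls.\<close>
    define \<phi> where "\<phi> t = s (t *\<^sub>R w) - t\<^sup>2 / 2 * Q" for t :: real
    have tw: "norm (t *\<^sub>R w) < r" if "0 \<le> t" "t \<le> 1" for t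
      using that w by (simp) (metis mult_left_le_one_le norm_ge_zero order_le_less_trans)
    have der: "(\<phi> has_real_derivative (frechet_derivative s (at (t *\<^sub>R w)) w - t * Q)) (at t)" if "0 \<le> t" "t \<le> 1" for t
    proof -
      have inS: "t *\<^sub>R w \<in> S" using tw[OF that] r r0 by auto
      have "(s has_derivative frechet_derivative s (at (t *\<^sub>R w))) (at (t *\<^sub>R w))"
        using d1[OF inS] frechet_derivative_works by blast
      moreover have "((\<lambda>t. t *\<^sub>R w) has_derivative (\<lambda>h. h *\<^sub>R w)) (at t)"
        by (auto intro!: derivative_eq_intros)
      ultimately have "((\<lambda>t. s (t *\<^sub>R w)) has_derivative (\<lambda>h. frechet_derivative s (at (t *\<^sub>R w)) (h *\<^sub>R w))) (at t)"
        by (metis has_derivative_compose)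
      moreover have "frechet_derivative s (at (t *\<^sub>R w)) (h *\<^sub>R w) = frechet_derivative s (at (t *\<^sub>R w)) w * h" for h
        using linear_cmul[OF linear_frechet_derivative[OF d1[OF inS]]] by simp
      ultimately have "((\<lambda>t. s (t *\<^sub>R w)) has_real_derivative frechet_derivative s (at (t *\<^sub>R w)) w) (at t)"
        by (simp add: has_field_derivative_def)
      then show ?thesis unfolding \<phi>_def[abs_def]
        by (auto intro!: derivative_eq_intros)
    qed
    obtain \<xi> where \<xi>: "0 < \<xi>" "\<xi> < 1" "\<phi> 1 - \<phi> 0 = (1 - 0) * (frechet_derivative s (at (\<xi> *\<^sub>R w)) w - \<xi> * Q)"
      using MVT2[of 0 1 \<phi> "\<lambda>t. frechet_derivative s (at (t *\<^sub>R w)) w - t * Q"] der by auto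
    have "\<xi> * Q = (\<Sum>j\<in>UNIV. w $ j * (\<Sum>i\<in>UNIV. (\<xi> *\<^sub>R w) $ i * ?H $ i $ j))"
      by (simp add: Q sum_distrib_left mult_ac)
    then have "\<bar>\<phi> 1 - \<phi> 0\<bar> \<le> e * norm w * norm (\<xi> *\<^sub>R w)"
      using bound[OF tw, of \<xi> w] \<xi> by simp
    also have "\<dots> \<le> e * norm w * norm w"
      using \<xi> e by (intro mult_left_mono) (auto simp: mult_left_le_one_le)
    finally show "w \<in> S \<and> \<bar>s w - (w \<bullet> (?H *v w)) / 2\<bar> \<le> e * (norm w)\<^sup>2"
      using w r r0 by (auto simp: \<phi>_def s0 Q_def[symmetric] power2_eq_square mult_ac)
  qed
qed

text \<open>In the coordinates \<open>p\<close>, \<open>q\<close> of \<open>u\<close>,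
  \<open>v\<close> in the two eigenbases, the form of the curvature matrix at the stacked vector is
  2a\<eta> times the sum of the two Hessian forms, minus |u - v|^2: the off-diagonal blocks
  contribute twice the inner product of \<open>u\<close> and \<open>v\<close>, which completes the
  square.\<close>

lemma curvature_bound:
  fixes Hl Hr Ul Ur :: "real^'n^'n"
  assumes l: "orthonormal_eigenbasis Hl \<kappa>l Ul" and r: "orthonormal_eigenbasis Hr \<kappa>r Ur"
    and psd: "positive_semidefinite (curvature_matrix a \<kappa>l Ul \<kappa>r Ur \<eta>)"
  shows "(norm (u - v))\<^sup>2 \<le> 2 * a * \<eta> * (u \<bullet> (Hl *v u) + v \<bullet> (Hr *v v))"
proof -
  have diag: "transpose U ** H ** U = diag_matrix \<kappa>" if "orthonormal_eigenbasis H \<kappa> U" for H \<kappa> and U :: "real^'n^'n"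
  proof -
    have o: "transpose U ** U = mat 1" and ev: "\<And>i. H *v column i U = \<kappa> i *\<^sub>R column i U"
      using that by (auto simp: orthonormal_eigenbasis_def orthogonal_matrix_def)
    have "(H ** U) = U ** diag_matrix \<kappa>"
    proof -
      have "(H ** U) $ i $ j = (U ** diag_matrix \<kappa>) $ i $ j" for i j
      proof -
        have "(H ** U) $ i $ j = (H *v column j U) $ i"
          by (simp add: matrix_matrix_mult_def matrix_vector_mult_def column_def)
        also have "\<dots> = (\<kappa> j *\<^sub>R column j U) $ i" by (simp only: ev)
        also have "\<dots> = \<kappa> j * U $ i $ j" by (simp add: column_def)
        also have "\<dots> = (U ** diag_matrix \<kappa>) $ i $ j"
          by (simp add: matrix_matrix_mult_def diag_matrix_def if_distrib[of "\<lambda>x. _ * x"] cong: if_cong)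
        finally show ?thesis .
      qed
      then show ?thesis by (simp add: vec_eq_iff)
    qed
    then have "transpose U ** (H ** U) = (transpose U ** U) ** diag_matrix \<kappa>"
      by (simp add: matrix_mul_assoc)
    then show ?thesis by (simp add: o matrix_mul_assoc)
  qed
  have adj: "x \<bullet> (transpose U *v y) = (U *v x) \<bullet> y" for U :: "real^'n^'n" and x y
    by (metis dot_lmul_matrix inner_commute transpose_matrix_vector)
  have inv: "U *v (transpose U *v x) = x" if "orthonormal_eigenbasis H \<kappa> U" for H \<kappa> and U :: "real^'n^'n" and x
    using that
    by (simp add: orthonormal_eigenbasis_def orthogonal_matrix_def matrix_vector_mul_assoc del: transpose_matrix_vector)
  define p q where "p = transpose Ul *v u" and "q = transpose Ur *v v"
  have pu: "Ul *v p = u" and qv: "Ur *v q = v"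
    unfolding p_def q_def by (rule inv[OF l], rule inv[OF r])
  note [simp del] = transpose_matrix_vector
  have Dl: "p \<bullet> (diag_matrix \<kappa>l *v p) = u \<bullet> (Hl *v u)"
    unfolding diag[OF l, symmetric] by (simp add: matrix_vector_mul_assoc[symmetric] pu adj)
  have Dr: "q \<bullet> (diag_matrix \<kappa>r *v q) = v \<bullet> (Hr *v v)"
    unfolding diag[OF r, symmetric] by (simp add: matrix_vector_mul_assoc[symmetric] qv adj)
  have pp: "p \<bullet> p = u \<bullet> u" using adj[of p Ul u] unfolding p_def[symmetric] pu .
  have qq: "q \<bullet> q = v \<bullet> v" using adj[of q Ur v] unfolding q_def[symmetric] qv .
  have pq: "p \<bullet> ((transpose Ul ** Ur) *v q) = u \<bullet> v"
    by (simp add: matrix_vector_mul_assoc[symmetric] qv adj pu)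
  have qp: "q \<bullet> ((transpose Ur ** Ul) *v p) = u \<bullet> v"
    by (simp add: matrix_vector_mul_assoc[symmetric] qv adj pu inner_commute)
  define w :: "real^('n+'n)" where "w = (\<chi> i. case i of Inl k \<Rightarrow> p $ k | Inr k \<Rightarrow> q $ k)"
  have block: "w \<bullet> (block_matrix A B C D *v w) = p \<bullet> (A *v p) + p \<bullet> (B *v q) + q \<bullet> (C *v p) + q \<bullet> (D *v q)" for A B C D
    by (simp add: w_def block_matrix_def inner_vec_def matrix_vector_mult_def UNIV_Plus_UNIV[symmetric]
        sum.Plus distrib_left sum.distrib del: UNIV_Plus_UNIV)
  have "0 \<le> w \<bullet> (curvature_matrix a \<kappa>l Ul \<kappa>r Ur \<eta> *v w)"
    using psd by (simp add: positive_semidefinite_def)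
  also have "\<dots> = 2 * a * \<eta> * (u \<bullet> (Hl *v u)) - u \<bullet> u + u \<bullet> v + u \<bullet> v + (2 * a * \<eta> * (v \<bullet> (Hr *v v)) - v \<bullet> v)"
    unfolding curvature_matrix_def block
    by (simp add: pq qp matrix_vector_mult_diff_rdistrib scaleR_matrix_vector_assoc[symmetric] inner_diff_right Dl Dr pp qq)
  finally show ?thesis
    by (simp add: power2_norm_eq_inner inner_diff_left inner_diff_right inner_commute algebra_simps)
qed

subsection \<open>Avoidance probabilities\<close>

lemma (in prob_space) occupancy_sets:
  assumes "finite I" "\<And>i. i \<in> I \<Longrightarrow> A i \<in> events"
  shows "{\<omega> \<in> space M. {i \<in> I. \<omega> \<in> A i} = T} \<in> events"
proof (cases "T \<subseteq> I")
  case True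
  have "{\<omega> \<in> space M. \<omega> \<in> A i \<longleftrightarrow> i \<in> T} \<in> events" if "i \<in> I" for i
  proof (cases "i \<in> T")
    case True
    then have "{\<omega> \<in> space M. \<omega> \<in> A i \<longleftrightarrow> i \<in> T} = A i"
      using sets.sets_into_space[OF assms(2)[OF that]] by auto
    then show ?thesis using assms(2)[OF that] by simp
  next
    case False
    then have "{\<omega> \<in> space M. \<omega> \<in> A i \<longleftrightarrow> i \<in> T} = space M - A i" by auto
    then show ?thesis using assms(2)[OF that] by simp
  qed
  then have "{\<omega> \<in> space M. \<forall>i\<in>I. \<omega> \<in> A i \<longleftrightarrow> i \<in> T} \<in> events"
    by (intro sets.sets_Collect_finite_All assms(1)) auto
  also have "{\<omega> \<in> space M. \<forall>i\<in>I. \<omega> \<in> A i \<longleftrightarrow> i \<in> T} = {\<omega> \<in> space M. {i \<in> I. \<omega> \<in> A i} = T}"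
    using True by auto
  finally show ?thesis .
next
  case False
  then have "{\<omega> \<in> space M. {i \<in> I. \<omega> \<in> A i} = T} = {}" by auto
  then show ?thesis by (simp only: sets.empty_sets)
qed

lemma (in prob_space) prob_occupancy:
  assumes "finite I" "\<And>i. i \<in> I \<Longrightarrow> A i \<in> events"
  shows "prob {\<omega> \<in> space M. {i \<in> I. \<omega> \<in> A i} \<in> F}
    = (\<Sum>T\<in>Pow I \<inter> F. prob {\<omega> \<in> space M. {i \<in> I. \<omega> \<in> A i} = T})"
proof -
  have "{\<omega> \<in> space M. {i \<in> I. \<omega> \<in> A i} \<in> F}
    = (\<Union>T\<in>Pow I \<inter> F. {\<omega> \<in> space M. {i \<in> I. \<omega> \<in> A i} = T})" by auto
  then show ?thesis
    using finite_measure_finite_Union[of "Pow I \<inter> F" "\<lambda>T. {\<omega> \<in> space M. {i \<in> I. \<omega> \<in> A i} = T}"]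
      occupancy_sets[OF assms] assms(1)
    by (force simp: disjoint_family_on_def)
qed

text \<open>
  The law of the set of events that occur is determined by the avoidance probabilities, through
  inclusion-exclusion; the induction below is on the value of that random set.
\<close>

lemma occupancy_convergence:
  fixes A :: "nat \<Rightarrow> 'i \<Rightarrow> 'w set" and B :: "'i \<Rightarrow> 'v set"
  assumes M: "prob_space M" and M': "prob_space M'" and I: "finite I"
    and A: "\<And>n i. i \<in> I \<Longrightarrow> A n i \<in> sets M" and B: "\<And>i. i \<in> I \<Longrightarrow> B i \<in> sets M'"
    and void: "\<And>J. J \<subseteq> I \<Longrightarrow> (\<lambda>n. measure M (space M - (\<Union>i\<in>J. A n i)))
      \<longlonglongrightarrow> measure M' (space M' - (\<Union>i\<in>J. B i))"
  shows "(\<lambda>n. measure M {\<omega> \<in> space M. {i \<in> I. \<omega> \<in> A n i} \<in> F})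
    \<longlonglongrightarrow> measure M' {\<omega> \<in> space M'. {i \<in> I. \<omega> \<in> B i} \<in> F}"
proof -
  interpret M: prob_space M by fact
  interpret M': prob_space M' by fact
  define p where "p n T = measure M {\<omega> \<in> space M. {i \<in> I. \<omega> \<in> A n i} = T}" for n T
  define p' where "p' T = measure M' {\<omega> \<in> space M'. {i \<in> I. \<omega> \<in> B i} = T}" for T
  have occ: "measure M {\<omega> \<in> space M. {i \<in> I. \<omega> \<in> A n i} \<in> F} = (\<Sum>T\<in>Pow I \<inter> F. p n T)" for n F
    unfolding p_def by (rule M.prob_occupancy[OF I]) (rule A)
  have occ': "measure M' {\<omega> \<in> space M'. {i \<in> I. \<omega> \<in> B i} \<in> F} = (\<Sum>T\<in>Pow I \<inter> F. p' T)" for F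
    unfolding p'_def by (rule M'.prob_occupancy[OF I]) (rule B)
  have pw: "(\<lambda>n. p n T) \<longlonglongrightarrow> p' T" if "T \<subseteq> I" for T
    using finite_subset[OF that I] that
  proof (induction T rule: finite_psubset_induct)
    case (psubset T)
    \<comment> \<open>Applied with \<open>v\<close> the probability that the random set is contained
      in \<open>T\<close>. Removing the proper subsets isolates \<open>T\<close>, and those are
      covered by the induction hypothesis.\<close>
    have split: "p0 T = v - (\<Sum>T'\<in>Pow T - {T}. p0 T')" if "v = (\<Sum>T'\<in>Pow T. p0 T')" for v :: real and p0
      using psubset.hyps that by (subst that, subst sum.remove[of "Pow T" T]) auto
    have PI: "Pow I \<inter> Pow T = Pow T" using psubset.prems by auto
    \<comment> \<open>Avoiding every index outside \<open>T\<close> is the same as producing a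
      subset of \<open>T\<close>, so \<open>void\<close> yields these cumulative
      probabilities.\<close>
    have "space M - (\<Union>i\<in>I - T. A n i) = {\<omega> \<in> space M. {i \<in> I. \<omega> \<in> A n i} \<in> Pow T}" for n by auto
    then have "measure M (space M - (\<Union>i\<in>I - T. A n i)) = (\<Sum>T'\<in>Pow T. p n T')" for n
      using occ[of n "Pow T"] by (simp only: PI)
    then have 1: "p n T = measure M (space M - (\<Union>i\<in>I - T. A n i)) - (\<Sum>T'\<in>Pow T - {T}. p n T')" for n
      using split by blast
    have "space M' - (\<Union>i\<in>I - T. B i) = {\<omega> \<in> space M'. {i \<in> I. \<omega> \<in> B i} \<in> Pow T}" by auto
    then have "measure M' (space M' - (\<Union>i\<in>I - T. B i)) = (\<Sum>T'\<in>Pow T. p' T')"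
      using occ'[of "Pow T"] by (simp only: PI)
    then have 2: "p' T = measure M' (space M' - (\<Union>i\<in>I - T. B i)) - (\<Sum>T'\<in>Pow T - {T}. p' T')"
      using split by blast
    show ?case unfolding 1 2
      using psubset by (intro tendsto_diff void tendsto_sum) auto
  qed
  show ?thesis
    unfolding occ occ'
    by (intro tendsto_sum pw) auto
qed

section \<open>Avoidance by samples of fixed and of Poisson size\<close>

text \<open>As \<open>q\<close> varies with \<open>n\<close>, the bounds exp (- q / (1 - q)) \<le> 1
  - q \<le> exp (- q) are raised to the power \<open>n\<close>; both exponents then tend to -c
  because q tends to 0.\<close>

lemma tendsto_one_minus_power_exp:
  fixes q :: "nat \<Rightarrow> real"
  assumes lim: "(\<lambda>n. real n * q n) \<longlonglongrightarrow> c" and q: "\<And>n. 0 \<le> q n"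
  shows "(\<lambda>n. (1 - q n) ^ n) \<longlonglongrightarrow> exp (- c)"
proof -
  have "(\<lambda>n. real n * q n * inverse (real n)) \<longlonglongrightarrow> c * 0"
    by (intro tendsto_mult lim lim_inverse_n)
  moreover have "\<forall>\<^sub>F n in sequentially. real n * q n * inverse (real n) = q n"
    using eventually_gt_at_top[of 0] by eventually_elim simp
  ultimately have q0: "q \<longlonglongrightarrow> 0"
    using Lim_transform_eventually by fastforce
  have small: "\<forall>\<^sub>F n in sequentially. q n < 1"
    using order_tendstoD(2)[OF q0] by auto
  have "(\<lambda>n. exp (- (real n * q n / (1 - q n)))) \<longlonglongrightarrow> exp (- (c / (1 - 0)))"
    by (intro tendsto_intros lim q0) auto
  then have lower: "(\<lambda>n. exp (- (real n * q n / (1 - q n)))) \<longlonglongrightarrow> exp (- c)" by simp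
  have upper: "(\<lambda>n. exp (- (real n * q n))) \<longlonglongrightarrow> exp (- c)"
    by (intro tendsto_intros lim)
  show ?thesis
  proof (rule tendsto_sandwich[OF _ _ lower upper])
    show "\<forall>\<^sub>F n in sequentially. exp (- (real n * q n / (1 - q n))) \<le> (1 - q n) ^ n"
      using small
    proof eventually_elim
      case (elim n)
      have "1 / (1 - q n) = 1 + q n / (1 - q n)" using elim by (simp add: field_simps)
      also have "\<dots> \<le> exp (q n / (1 - q n))" by (rule exp_ge_add_one_self)
      finally have "exp (- (q n / (1 - q n))) \<le> 1 - q n"
        using elim by (simp add: exp_minus field_simps)
      then have "exp (- (q n / (1 - q n))) ^ n \<le> (1 - q n) ^ n" by (intro power_mono) auto
      then show ?case by (simp add: exp_of_nat_mult[symmetric])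
    qed
    show "\<forall>\<^sub>F n in sequentially. (1 - q n) ^ n \<le> exp (- (real n * q n))"
      using small
    proof eventually_elim
      case (elim n)
      have "1 - q n \<le> exp (- q n)" using exp_ge_add_one_self[of "- q n"] by simp
      then have "(1 - q n) ^ n \<le> exp (- q n) ^ n" using elim by (intro power_mono) auto
      then show ?case by (simp add: exp_of_nat_mult[symmetric])
    qed
  qed
qed

lemma (in prob_space) prob_iid_avoid:
  assumes ind: "indep_vars (\<lambda>_. borel) Z (UNIV :: nat set)"
    and dist: "\<And>i. distr M borel (Z i) = distr M borel (Z 0)"
    and B: "B \<in> sets borel"
  shows "prob {\<omega> \<in> space M. \<forall>i<n. Z i \<omega> \<notin> B} = (1 - prob {\<omega> \<in> space M. Z 0 \<omega> \<in> B}) ^ n"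
proof (cases "n = 0")
  case True then show ?thesis by (simp add: prob_space)
next
  case False
  note [measurable] = B
  have [measurable]: "Z i \<in> borel_measurable M" for i
    using ind by (auto simp: indep_vars_def)
  have eq: "prob (Z i -` (- B) \<inter> space M) = 1 - prob {\<omega> \<in> space M. Z 0 \<omega> \<in> B}" for i
  proof -
    have "prob (Z i -` (- B) \<inter> space M) = measure (distr M borel (Z i)) (- B)"
      using B by (subst measure_distr) (auto simp: borel_comp)
    also have "\<dots> = measure (distr M borel (Z 0)) (- B)" by (simp only: dist[of i])
    also have "\<dots> = prob (space M - {\<omega> \<in> space M. Z 0 \<omega> \<in> B})"
      using B by (subst measure_distr) (auto simp: borel_comp intro!: arg_cong[of _ _ prob])
    also have "\<dots> = 1 - prob {\<omega> \<in> space M. Z 0 \<omega> \<in> B}"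
      using B by (intro prob_compl) measurable
    finally show ?thesis .
  qed
  have "prob (\<Inter>i\<in>{..<n}. Z i -` (- B) \<inter> space M) = (\<Prod>i<n. prob (Z i -` (- B) \<inter> space M))"
    using False B by (intro indep_varsD[OF ind]) (auto simp: borel_comp)
  moreover have "(\<Inter>i\<in>{..<n}. Z i -` (- B) \<inter> space M) = {\<omega> \<in> space M. \<forall>i<n. Z i \<omega> \<notin> B}"
    using False by auto
  ultimately show ?thesis by (simp add: eq)
qed

text \<open>Splitting by the value \<open>k\<close> of \<open>N\<close> gives the sum of exp (- r)
  r^k (1 - q)^k / k!, an exponential series. With a Poisson sample size the avoidance probability is
  thus exact for every \<open>r\<close>, not only in the limit.\<close>

lemma (in prob_space) prob_poisson_avoid:
  assumes ind: "indep_vars (\<lambda>_. borel) Z (UNIV :: nat set)"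
    and dist: "\<And>i. distr M borel (Z i) = distr M borel (Z 0)"
    and N: "N \<in> measurable M (count_space UNIV)"
      "distr M (count_space UNIV) N = measure_pmf (poisson_pmf r)"
    and r: "r > 0"
    and indN: "indep_set (sets (vimage_algebra (space M) N (count_space UNIV)))
           (sets (vimage_algebra (space M) (\<lambda>\<omega> i. Z i \<omega>) (Pi\<^sub>M UNIV (\<lambda>_. borel))))"
    and B: "B \<in> sets borel"
  shows "prob {\<omega> \<in> space M. \<forall>i<N \<omega>. Z i \<omega> \<notin> B} = exp (- (r * prob {\<omega> \<in> space M. Z 0 \<omega> \<in> B}))"
proof -
  note [measurable] = N(1) B
  have [measurable]: "Z i \<in> borel_measurable M" for i
    using ind by (auto simp: indep_vars_def)
  define q where "q = prob {\<omega> \<in> space M. Z 0 \<omega> \<in> B}"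
  define F where "F k = {\<omega> \<in> space M. N \<omega> = k \<and> (\<forall>i<k. Z i \<omega> \<notin> B)}" for k
  have Fk: "prob (F k) = exp (- r) * ((r * (1 - q)) ^ k /\<^sub>R fact k)" for k
  proof -
    have a: "{\<omega> \<in> space M. N \<omega> = k} \<in> sets (vimage_algebra (space M) N (count_space UNIV))"
      using in_vimage_algebra[of "{k}" "count_space UNIV" N "space M"]
      by (simp add: vimage_def Collect_conj_eq Int_commute)
    have "{z \<in> space (Pi\<^sub>M UNIV (\<lambda>_. borel)). \<forall>i<k. z i \<notin> B} \<in> sets (Pi\<^sub>M UNIV (\<lambda>_. borel))"
      by measurable
    from in_vimage_algebra[OF this, of "\<lambda>\<omega> i. Z i \<omega>" "space M"]
    have b: "{\<omega> \<in> space M. \<forall>i<k. Z i \<omega> \<notin> B} \<in> sets (vimage_algebra (space M) (\<lambda>\<omega> i. Z i \<omega>) (Pi\<^sub>M UNIV (\<lambda>_. borel)))"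
      by (simp add: vimage_def space_PiM Collect_conj_eq Int_commute)
    have "F k = {\<omega> \<in> space M. N \<omega> = k} \<inter> {\<omega> \<in> space M. \<forall>i<k. Z i \<omega> \<notin> B}"
      by (auto simp: F_def)
    then have "prob (F k) = prob {\<omega> \<in> space M. N \<omega> = k} * (1 - q) ^ k"
      using indep_setD[OF indN a b] prob_iid_avoid[OF ind dist B] by (simp add: q_def)
    also have "prob {\<omega> \<in> space M. N \<omega> = k} = measure (distr M (count_space UNIV) N) {k}"
      by (subst measure_distr) (auto intro!: arg_cong[of _ _ prob])
    also have "\<dots> = r ^ k / fact k * exp (- r)"
      using r by (simp add: N(2) measure_pmf_single)
    finally show ?thesis by (simp add: power_mult_distrib divide_inverse mult_ac)
  qed
  have "(\<lambda>k. prob (F k)) sums prob (\<Union>k. F k)"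
    by (intro finite_measure_UNION) (auto simp: F_def disjoint_family_on_def)
  moreover have "(\<Union>k. F k) = {\<omega> \<in> space M. \<forall>i<N \<omega>. Z i \<omega> \<notin> B}"
    by (auto simp: F_def)
  moreover have "(\<lambda>k. prob (F k)) sums (exp (- r) * exp (r * (1 - q)))"
    unfolding Fk by (intro sums_mult exp_converges)
  ultimately have "prob {\<omega> \<in> space M. \<forall>i<N \<omega>. Z i \<omega> \<notin> B} = exp (- r) * exp (r * (1 - q))"
    using sums_unique2 by metis
  also have "\<dots> = exp (- (r * q))" by (simp add: exp_add[symmetric] algebra_simps)
  finally show ?thesis by (simp add: q_def)
qed

subsection \<open>Scaling at the poles\<close>

text \<open>
  The side \<open>\<sigma>\<close> is \<open>-1\<close> at the left and \<open>1\<close> at the right pole. With \<open>\<rho> = n powr (- 1 / (d + 1))\<close>,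
  \<open>cap_chart a \<sigma> \<rho>\<close> has Jacobian \<open>\<rho> ^ (d + 1) = 1 / n\<close>.
\<close>

definition cap_chart :: "real \<Rightarrow> real \<Rightarrow> real \<Rightarrow> real \<times> (real^'n) \<Rightarrow> real \<times> (real^'n)" where
  "cap_chart a \<sigma> \<rho> x = (\<sigma> * (a - \<rho>\<^sup>2 * fst x), \<rho> *\<^sub>R snd x)"

text \<open>The inverse chart. Its first coordinate is a scaled depth measured inwards from the
  pole, so both caps become sets above a quadratic form in the limit, although the poles face
  opposite ways.\<close>

definition cap_rescale :: "real \<Rightarrow> real \<Rightarrow> real \<Rightarrow> real \<times> (real^'n) \<Rightarrow> real \<times> (real^'n)" where
  "cap_rescale a \<sigma> \<rho> z = ((a - \<sigma> * fst z) / \<rho>\<^sup>2, (1 / \<rho>) *\<^sub>R snd z)"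

lemma cap_chart_rescale:
  assumes "\<sigma> \<in> {-1, 1}" "\<rho> > 0"
  shows "cap_chart a \<sigma> \<rho> (cap_rescale a \<sigma> \<rho> z) = z"
  using assms by (cases z) (auto simp: cap_chart_def cap_rescale_def)

lemma cap_rescale_chart:
  assumes "\<sigma> \<in> {-1, 1}" "\<rho> > 0"
  shows "cap_rescale a \<sigma> \<rho> (cap_chart a \<sigma> \<rho> x) = x"
  using assms by (cases x) (auto simp: cap_chart_def cap_rescale_def)

text \<open>One cap with its side put into the sign: \<sigma> times the first coordinate increases
  towards the pole on either side, so each statement on caps is proved once for both.\<close>

definition pole_cap :: "real \<Rightarrow> (real \<times> (real^'n)) set \<Rightarrow> real \<Rightarrow> (real^'n \<Rightarrow> real) \<Rightarrow> bool" where
  "pole_cap a E \<sigma> s \<longleftrightarrow> \<sigma> \<in> {-1, 1} \<and> (\<sigma> * a, 0) \<in> E \<and>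
     (\<exists>\<delta> S. 0 < \<delta> \<and> cap_function S s \<and>
       E \<inter> {z. a - \<delta> < \<sigma> * fst z} = {z. a - \<delta> < \<sigma> * fst z \<and> \<sigma> * fst z \<le> a - s (snd z) \<and> snd z \<in> S})"

lemma smooth_pole_caps_pole_cap:
  assumes "smooth_pole_caps a E sl sr" and "(- a, 0) \<in> E" "(a, 0) \<in> E"
  shows "pole_cap a E (- 1) sl" and "pole_cap a E 1 sr"
proof -
  obtain \<delta>l \<delta>r Ol Or where *: "\<delta>l \<in> {0<..a}" "\<delta>r \<in> {0<..a}" "cap_function Ol sl" "cap_function Or sr"
    and l: "E \<inter> {z. fst z < -a + \<delta>l} = {(z1, w). -a + sl w \<le> z1 \<and> z1 < -a + \<delta>l \<and> w \<in> Ol}"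
    and r: "E \<inter> {z. a - \<delta>r < fst z} = {(z1, w). a - \<delta>r < z1 \<and> z1 \<le> a - sr w \<and> w \<in> Or}"
    using assms(1) unfolding smooth_pole_caps_def by blast
  have "E \<inter> {z. a - \<delta>l < - 1 * fst z} = E \<inter> {z. fst z < -a + \<delta>l}" by auto
  also note l
  also have "{(z1, w). -a + sl w \<le> z1 \<and> z1 < -a + \<delta>l \<and> w \<in> Ol}
      = {z. a - \<delta>l < - 1 * fst z \<and> - 1 * fst z \<le> a - sl (snd z) \<and> snd z \<in> Ol}" by auto
  finally show "pole_cap a E (- 1) sl" using assms * unfolding pole_cap_def by auto
  have "{(z1, w). a - \<delta>r < z1 \<and> z1 \<le> a - sr w \<and> w \<in> Or}
      = {z. a - \<delta>r < 1 * fst z \<and> 1 * fst z \<le> a - sr (snd z) \<and> snd z \<in> Or}" by auto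
  with r show "pole_cap a E 1 sr" using assms * unfolding pole_cap_def by auto
qed

text \<open>Close to the pole the cutoff \<delta> and the domain of \<open>s\<close> impose nothing
  further, so membership in \<open>E\<close> is a comparison of the depth with
  \<open>s\<close>.\<close>

lemma pole_cap_local:
  fixes E :: "(real \<times> (real^'n)) set"
  assumes cap: "pole_cap a E \<sigma> s" and e: "e > 0"
  obtains r where "r > 0"
    "\<And>z. dist z (\<sigma> * a, 0) < r \<Longrightarrow> z \<in> E \<longleftrightarrow> s (snd z) \<le> a - \<sigma> * fst z"
    "\<And>z. dist z (\<sigma> * a, 0) < r \<Longrightarrow> \<bar>s (snd z) - (snd z \<bullet> (hessian s 0 *v snd z)) / 2\<bar> \<le> e * (norm (snd z))\<^sup>2"
proof -
  have \<sigma>: "\<sigma> \<in> {-1, 1}" and pole: "(\<sigma> * a, 0) \<in> E"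
    using cap by (auto simp: pole_cap_def)
  obtain \<delta> S where \<delta>: "0 < \<delta>" and S: "cap_function S s"
    and E: "E \<inter> {z. a - \<delta> < \<sigma> * fst z} = {z. a - \<delta> < \<sigma> * fst z \<and> \<sigma> * fst z \<le> a - s (snd z) \<and> snd z \<in> S}"
    using cap unfolding pole_cap_def by blast
  have mem: "z \<in> E \<longleftrightarrow> \<sigma> * fst z \<le> a - s (snd z) \<and> snd z \<in> S" if "a - \<delta> < \<sigma> * fst z" for z
    using E that by blast
  have \<sigma>2: "\<sigma> * (\<sigma> * a) = a" using \<sigma> by auto
  have "s 0 \<le> 0" using mem[of "(\<sigma> * a, 0)"] pole \<delta> \<sigma>2 by simp
  moreover have "0 \<le> s 0" using S by (auto simp: cap_function_def)
  ultimately have "s 0 = 0" by simp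
  from cap_function_quadratic_approx[OF S this e] obtain r where r: "r > 0"
    and approx: "\<And>w. norm w < r \<Longrightarrow> w \<in> S \<and> \<bar>s w - (w \<bullet> (hessian s 0 *v w)) / 2\<bar> \<le> e * (norm w)\<^sup>2"
    by blast
  show thesis
  proof (rule that[of "min r \<delta>"])
    show "min r \<delta> > 0" using r \<delta> by simp
    fix z :: "real \<times> (real^'n)" assume z: "dist z (\<sigma> * a, 0) < min r \<delta>"
    have "dist (snd z) 0 \<le> dist z (\<sigma> * a, 0)" using dist_snd_le[of z "(\<sigma> * a, 0)"] by simp
    with z have snd: "norm (snd z) < r" by simp
    have "\<bar>fst z - \<sigma> * a\<bar> \<le> dist z (\<sigma> * a, 0)"
      using dist_fst_le[of z "(\<sigma> * a, 0)"] by (simp add: dist_real_def)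
    with z have "a - \<delta> < \<sigma> * fst z" using \<sigma> by (auto simp: abs_if split: if_splits)
    from mem[OF this] show "z \<in> E \<longleftrightarrow> s (snd z) \<le> a - \<sigma> * fst z"
      using approx[OF snd] by auto
    show "\<bar>s (snd z) - (snd z \<bullet> (hessian s 0 *v snd z)) / 2\<bar> \<le> e * (norm (snd z))\<^sup>2"
      using approx[OF snd] by blast
  qed
qed

section \<open>Localisation of nearly diametral pairs\<close>

text \<open>Removing the two products of pole neighbourhoods leaves a compact set of pairs. The
  distance stays below 2a on it and attains a maximum there; the gap to 2a is \<theta>, and any
  \<theta> serves if no pair is left.\<close>

lemma unique_diameter_near_poles:
  fixes E :: "(real \<times> (real^'n)) set"
  assumes ud: "unique_diameter a E" and r: "r > 0"
  obtains \<theta> where "\<theta> > 0"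
    "\<And>x y. x \<in> E \<Longrightarrow> y \<in> E \<Longrightarrow> 2 * a - norm (x - y) < \<theta> \<Longrightarrow>
      (x \<in> ball (- a, 0) r \<and> y \<in> ball (a, 0) r) \<or> (y \<in> ball (- a, 0) r \<and> x \<in> ball (a, 0) r)"
proof -
  let ?l = "(- a, 0) :: real \<times> (real^'n)" and ?r = "(a, 0) :: real \<times> (real^'n)"
  have E: "compact E" and a: "a > 0" and dm: "diameter E = 2 * a"
    and uniq: "\<And>x y. x \<in> E \<Longrightarrow> y \<in> E \<Longrightarrow> x \<noteq> ?l \<Longrightarrow> x \<noteq> ?r \<Longrightarrow> norm (x - y) < 2 * a"
    using ud by (auto simp: unique_diameter_def compact_eq_bounded_closed)
  define K where "K = E \<times> E - (ball ?l r \<times> ball ?r r \<union> ball ?r r \<times> ball ?l r)"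
  have K: "compact K"
    unfolding K_def by (intro compact_diff compact_Times E open_Un open_Times) auto
  have lt: "norm (fst p - snd p) < 2 * a" if "p \<in> K" for p
  proof (rule ccontr)
    assume n: "\<not> norm (fst p - snd p) < 2 * a"
    obtain x y where p: "p = (x, y)" by (cases p)
    have xy: "x \<in> E" "y \<in> E" using that by (auto simp: K_def p)
    have "x \<in> {?l, ?r}" using uniq[OF xy] n p by auto
    moreover have "y \<in> {?l, ?r}" using uniq[OF xy(2,1)] n p by (auto simp: norm_minus_commute)
    \<comment> \<open>Both points are poles here. Equal poles have distance 0, and the two mixed
      pairs were removed from \<open>K\<close>.\<close>
    ultimately show False using that n r a by (auto simp: K_def p)
  qed
  show thesis
  proof (cases "K = {}")
    case True
    show thesis
      by (rule that[of 1]) (use True in \<open>auto simp: K_def\<close>)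
  next
    case False
    have "continuous_on K (\<lambda>p. norm (fst p - snd p))" by (intro continuous_intros)
    from continuous_attains_sup[OF K False this]
    obtain m where m: "m \<in> K" "\<And>p. p \<in> K \<Longrightarrow> norm (fst p - snd p) \<le> norm (fst m - snd m)" by blast
    show thesis
    proof (rule that[of "2 * a - norm (fst m - snd m)"])
      show "0 < 2 * a - norm (fst m - snd m)" using lt[OF m(1)] by simp
      fix x y assume xy: "x \<in> E" "y \<in> E" "2 * a - norm (x - y) < 2 * a - norm (fst m - snd m)"
      then have "(x, y) \<notin> K" using m(2)[of "(x, y)"] by auto
      then show "(x \<in> ball ?l r \<and> y \<in> ball ?r r) \<or> (y \<in> ball ?l r \<and> x \<in> ball ?r r)"
        using xy by (auto simp: K_def)
    qed
  qed
qed

lemma norm_Pair_sq: "(norm z)\<^sup>2 = (fst z)\<^sup>2 + (norm (snd z))\<^sup>2" for z :: "real \<times> 'b::real_normed_vector"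
  by (cases z) (simp add: norm_Pair)

text \<open>
  Because \<open>\<eta> < 1\<close>, the curvature condition leaves a fixed fraction of the total height of the two
  points as a lower bound for the deficit \<open>2 * a - norm (x - y)\<close>.
\<close>

lemma pole_deficit_bound:
  fixes E :: "(real \<times> (real^'n)) set"
  assumes a: "a > 0" and \<eta>: "0 < \<eta>" "\<eta> < 1"
    and capl: "pole_cap a E (- 1) sl" and capr: "pole_cap a E 1 sr"
    and curv: "\<And>u v. (norm (u - v))\<^sup>2 \<le> 2 * a * \<eta> * (u \<bullet> (hessian sl 0 *v u) + v \<bullet> (hessian sr 0 *v v))"
  obtains r c C where "r > 0" "c > 0" "C > 0"
    "\<And>x y. x \<in> E \<inter> ball (- a, 0) r \<Longrightarrow> y \<in> E \<inter> ball (a, 0) r \<Longrightarrow>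
       0 \<le> a + fst x \<and> 0 \<le> a - fst y \<and> c * (a + fst x + (a - fst y)) \<le> 2 * a - norm (x - y) \<and>
       (norm (snd x))\<^sup>2 \<le> C * (a + fst x) \<and> (norm (snd y))\<^sup>2 \<le> C * (a - fst y)"
proof -
  \<comment> \<open>The room between \<eta> and 1 is shared: the factor \<open>lam\<close> absorbs
    the Taylor error of the caps, and \<eta> / lam < 1 still leaves a fraction for the
    deficit.\<close>
  define lam where "lam = (1 + \<eta>) / 2"
  have lam: "\<eta> < lam" "lam < 1" "lam > 0" using \<eta> by (auto simp: lam_def)
  \<comment> \<open>Together with |w|^2 \<le> 2a\<eta>Q this makes the Taylor error at most (1 -
    lam) Q / 2, so a point of the cap has height at least lam Q / 2.\<close>
  define e where "e = (1 - lam) / (4 * a * \<eta>)"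
  have e: "e > 0" using a \<eta> lam by (simp add: e_def)
  \<comment> \<open>Chosen so that \<eta> / lam = 1 - 2c: of the fraction 2c that the transversal
    term leaves over, one c pays for h^2 and one c remains.\<close>
  define c where "c = (1 - \<eta> / lam) / 2"
  have c: "c > 0" using lam by (simp add: c_def diff_divide_distrib)
  define C where "C = 4 * a * \<eta> / lam"
  have C: "C > 0" using a \<eta> lam by (simp add: C_def)
  obtain r1 where r1: "r1 > 0"
    "\<And>z. dist z (- 1 * a, 0) < r1 \<Longrightarrow> z \<in> E \<longleftrightarrow> sl (snd z) \<le> a - - 1 * fst z"
    "\<And>z. dist z (- 1 * a, 0) < r1 \<Longrightarrow> \<bar>sl (snd z) - (snd z \<bullet> (hessian sl 0 *v snd z)) / 2\<bar> \<le> e * (norm (snd z))\<^sup>2"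
    using pole_cap_local[OF capl e] by blast
  obtain r2 where r2: "r2 > 0"
    "\<And>z. dist z (1 * a, 0) < r2 \<Longrightarrow> z \<in> E \<longleftrightarrow> sr (snd z) \<le> a - 1 * fst z"
    "\<And>z. dist z (1 * a, 0) < r2 \<Longrightarrow> \<bar>sr (snd z) - (snd z \<bullet> (hessian sr 0 *v snd z)) / 2\<bar> \<le> e * (norm (snd z))\<^sup>2"
    using pole_cap_local[OF capr e] by blast
  \<comment> \<open>The bound 2ac on the radius ensures h \<le> 4ac for the total height h, hence
    h^2 \<le> 4ach.\<close>
  define r where "r = min (min r1 r2) (2 * a * c)"
  have r: "r > 0" "r \<le> r1" "r \<le> r2" "r \<le> 2 * a * c" using r1 r2 a c by (auto simp: r_def)
  have height: "lam * (Q / 2) \<le> X \<and> 0 \<le> Q \<and> 0 \<le> X \<and> (norm w)\<^sup>2 \<le> C * X"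
    if w: "(norm w)\<^sup>2 \<le> 2 * a * \<eta> * Q" and s: "\<bar>s - Q / 2\<bar> \<le> e * (norm w)\<^sup>2" "s \<le> X"
    for w :: "real^'n" and Q s X
  proof -
    have "e * (norm w)\<^sup>2 \<le> e * (2 * a * \<eta> * Q)" using w e by (intro mult_left_mono) auto
    also have "\<dots> = (1 - lam) * (Q / 2)" using a \<eta> by (simp add: e_def)
    finally have 1: "lam * (Q / 2) \<le> X" using s by (simp add: algebra_simps)
    have Q: "0 \<le> Q"
      using order_trans[OF zero_le_power2 w] a \<eta>
      by (metis mult_le_cancel_left_pos mult_pos_pos mult_zero_right zero_less_numeral)
    have "C * (lam * (Q / 2)) \<le> C * X" using 1 C by (intro mult_left_mono) auto
    also have "C * (lam * (Q / 2)) = 2 * a * \<eta> * Q" using lam by (simp add: C_def)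
    finally have "(norm w)\<^sup>2 \<le> C * X" using w by simp
    moreover have "0 \<le> X" using 1 Q lam by (meson divide_nonneg_pos mult_nonneg_nonneg less_imp_le order_trans zero_less_numeral)
    ultimately show ?thesis using 1 Q by simp
  qed
  show thesis
  proof (rule that[OF r(1) c C])
    fix x y assume x: "x \<in> E \<inter> ball (- a, 0) r" and y: "y \<in> E \<inter> ball (a, 0) r"
    define u v where "u = snd x" and "v = snd y"
    define X Y where "X = a + fst x" and "Y = a - fst y"
    define Ql Qr where "Ql = u \<bullet> (hessian sl 0 *v u)" and "Qr = v \<bullet> (hessian sr 0 *v v)"
    have dx: "dist x (- 1 * a, 0) < r1" using x r by (simp add: dist_commute)
    have dy: "dist y (1 * a, 0) < r2" using y r by (simp add: dist_commute)
    \<comment> \<open>Curvature with the other vector set to 0 controls each transversal part by its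
      own Hessian form.\<close>
    have hx: "lam * (Ql / 2) \<le> X \<and> 0 \<le> Ql \<and> 0 \<le> X \<and> (norm u)\<^sup>2 \<le> C * X"
      using r1(2,3)[OF dx] x curv[of u 0] by (intro height[of u Ql "sl u" X]) (auto simp: u_def X_def Ql_def)
    have hy: "lam * (Qr / 2) \<le> Y \<and> 0 \<le> Qr \<and> 0 \<le> Y \<and> (norm v)\<^sup>2 \<le> C * Y"
      using r2(2,3)[OF dy] y curv[of 0 v] by (intro height[of v Qr "sr v" Y]) (auto simp: v_def Y_def Qr_def)
    define h where "h = X + Y"
    define L where "L = norm (x - y)"
    define q where "q = (norm (u - v))\<^sup>2"
    have h0: "0 \<le> h" using hx hy by (simp add: h_def)
    have "X \<le> r" using x dist_fst_le[of "(- a, 0)" x] by (auto simp: X_def dist_real_def)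
    moreover have "Y \<le> r" using y dist_fst_le[of "(a, 0)" y] by (auto simp: Y_def dist_real_def)
    ultimately have h: "h \<le> 4 * a * c" using r by (simp add: h_def)
    have "q \<le> 2 * a * \<eta> * (Ql + Qr)"
      unfolding q_def Ql_def Qr_def by (rule curv)
    also have "\<dots> = (4 * a * \<eta> / lam) * (lam * (Ql / 2) + lam * (Qr / 2))"
      using lam by (simp add: field_simps)
    also have "\<dots> \<le> (4 * a * \<eta> / lam) * h"
      using hx hy C unfolding h_def C_def[symmetric] by (intro mult_left_mono) auto
    finally have q: "q \<le> 4 * a * h * (\<eta> / lam)" by (simp add: mult_ac)
    have L2: "L\<^sup>2 = (2 * a - h)\<^sup>2 + q"
      unfolding L_def norm_Pair_sq by (simp add: h_def X_def Y_def q_def u_def v_def power2_eq_square algebra_simps)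
    have "h * h \<le> h * (4 * a * c)" using h h0 by (intro mult_left_mono)
    moreover have "\<eta> / lam = 1 - 2 * c" by (simp add: c_def diff_divide_distrib)
    ultimately have "4 * a * h * c \<le> 4 * a * h - h * h - q"
      using q unfolding \<open>\<eta> / lam = 1 - 2 * c\<close> by (simp add: algebra_simps)
    also have "\<dots> = (2 * a - L) * (2 * a + L)"
      using L2 by (simp add: power2_eq_square algebra_simps)
    finally have prod: "4 * a * h * c \<le> (2 * a - L) * (2 * a + L)" .
    have L0: "0 \<le> L" by (simp add: L_def)
    have "0 \<le> (2 * a - L) * (2 * a + L)"
      using prod h0 a c by (meson less_imp_le mult_nonneg_nonneg order_trans zero_le_numeral)
    then have L2a: "L \<le> 2 * a" using L0 a by (auto simp: zero_le_mult_iff)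
    \<comment> \<open>As L \<le> 2a, the factor 2a + L is at most 4a, which turns the bound on the
      product into one on 2a - L.\<close>
    have "(2 * a - L) * (2 * a + L) \<le> (2 * a - L) * (4 * a)"
      using L2a by (intro mult_left_mono) auto
    with prod have "4 * a * (c * h) \<le> 4 * a * (2 * a - L)" by (simp add: mult_ac)
    then have "c * h \<le> 2 * a - L" using a by simp
    then show "0 \<le> a + fst x \<and> 0 \<le> a - fst y \<and> c * (a + fst x + (a - fst y)) \<le> 2 * a - norm (x - y) \<and>
       (norm (snd x))\<^sup>2 \<le> C * (a + fst x) \<and> (norm (snd y))\<^sup>2 \<le> C * (a - fst y)"
      using hx hy by (simp add: h_def L_def X_def Y_def u_def v_def)
  qed
qed

lemma norm_le_height_bound:
  fixes z :: "real \<times> 'b::real_normed_vector"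
  assumes "0 \<le> fst z" "fst z \<le> T" "(norm (snd z))\<^sup>2 \<le> C * fst z" "0 \<le> C"
  shows "norm z \<le> T + sqrt (C * T)"
proof -
  have "norm z \<le> \<bar>fst z\<bar> + norm (snd z)"
    using norm_Pair_le[of "fst z" "snd z"] by simp
  moreover have "norm (snd z) \<le> sqrt (C * T)"
    using assms by (intro real_le_rsqrt order_trans[OF assms(3)] mult_left_mono)
  ultimately show ?thesis using assms by simp
qed

text \<open>Tightness on the sample side. A deficit of at most t\<rho>^2 falls below the threshold
  of \<open>unique_diameter_near_poles\<close> once \<rho> is small;
  \<open>pole_deficit_bound\<close> then limits the scaled heights to t/c and the transversal parts
  accordingly, with a radius free of \<rho>. The pair is stated as a set because either point may be
  the left one.\<close>

lemma far_pairs_in_window: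
  fixes E :: "(real \<times> (real^'n)) set"
  assumes a: "a > 0" and ud: "unique_diameter a E" and \<eta>: "0 < \<eta>" "\<eta> < 1"
    and capl: "pole_cap a E (- 1) sl" and capr: "pole_cap a E 1 sr"
    and curv: "\<And>u v. (norm (u - v))\<^sup>2 \<le> 2 * a * \<eta> * (u \<bullet> (hessian sl 0 *v u) + v \<bullet> (hessian sr 0 *v v))"
  obtains R where "\<forall>\<^sub>F \<rho> in at_right 0. \<forall>x\<in>E. \<forall>y\<in>E. (2 * a - norm (x - y)) / \<rho>\<^sup>2 \<le> t \<longrightarrow>
      (\<exists>u\<in>cball 0 R. \<exists>v\<in>cball 0 R. {x, y} = {cap_chart a (- 1) \<rho> u, cap_chart a 1 \<rho> v})"
proof -
  obtain r c C where r: "r > 0" and c: "c > 0" and C: "C > 0"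
    and bound: "\<And>x y. x \<in> E \<inter> ball (- a, 0) r \<Longrightarrow> y \<in> E \<inter> ball (a, 0) r \<Longrightarrow>
       0 \<le> a + fst x \<and> 0 \<le> a - fst y \<and> c * (a + fst x + (a - fst y)) \<le> 2 * a - norm (x - y) \<and>
       (norm (snd x))\<^sup>2 \<le> C * (a + fst x) \<and> (norm (snd y))\<^sup>2 \<le> C * (a - fst y)"
    using pole_deficit_bound[OF a \<eta> capl capr curv] by blast
  obtain \<theta> where \<theta>: "\<theta> > 0" "\<And>x y. x \<in> E \<Longrightarrow> y \<in> E \<Longrightarrow> 2 * a - norm (x - y) < \<theta> \<Longrightarrow>
      (x \<in> ball (- a, 0) r \<and> y \<in> ball (a, 0) r) \<or> (y \<in> ball (- a, 0) r \<and> x \<in> ball (a, 0) r)"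
    using unique_diameter_near_poles[OF ud r] by blast
  define R where "R = t / c + sqrt (C * (t / c))"
  have window: "\<exists>u\<in>cball 0 R. \<exists>v\<in>cball 0 R. x = cap_chart a (- 1) \<rho> u \<and> y = cap_chart a 1 \<rho> v"
    if \<rho>: "\<rho> > 0" and x: "x \<in> E \<inter> ball (- a, 0) r" and y: "y \<in> E \<inter> ball (a, 0) r"
      and t: "(2 * a - norm (x - y)) / \<rho>\<^sup>2 \<le> t" for x y \<rho>
  proof -
    define u where "u = cap_rescale a (- 1) \<rho> x"
    define v where "v = cap_rescale a 1 \<rho> y"
    have b: "0 \<le> a + fst x" "0 \<le> a - fst y" "c * (a + fst x + (a - fst y)) \<le> 2 * a - norm (x - y)"
       "(norm (snd x))\<^sup>2 \<le> C * (a + fst x)" "(norm (snd y))\<^sup>2 \<le> C * (a - fst y)"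
      using bound[OF x y] by auto
    have "c * (a + fst x + (a - fst y)) \<le> t * \<rho>\<^sup>2"
      using t b(3) \<rho> by (simp add: divide_le_eq)
    then have "(a + fst x + (a - fst y)) / \<rho>\<^sup>2 \<le> t / c"
      using c \<rho> by (simp add: divide_le_eq le_divide_eq mult_ac)
    then have h: "fst u + fst v \<le> t / c"
      by (simp add: u_def v_def cap_rescale_def add_divide_distrib[symmetric])
    have nn: "0 \<le> fst u" "0 \<le> fst v" using b \<rho> by (auto simp: u_def cap_rescale_def v_def)
    have sq: "(norm ((1 / \<rho>) *\<^sub>R w))\<^sup>2 = (norm w)\<^sup>2 / \<rho>\<^sup>2" for w :: "real^'n"
      using \<rho> by (simp add: power_divide)
    have "norm u \<le> R" unfolding R_def
      using h nn b(4) \<rho> C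
      by (intro norm_le_height_bound) (auto simp: u_def cap_rescale_def sq divide_right_mono simp del: norm_scaleR)
    moreover have "norm v \<le> R" unfolding R_def
      using h nn b(5) \<rho> C
      by (intro norm_le_height_bound) (auto simp: v_def cap_rescale_def sq divide_right_mono simp del: norm_scaleR)
    moreover have "x = cap_chart a (- 1) \<rho> u" "y = cap_chart a 1 \<rho> v"
      unfolding u_def v_def using \<rho> by (intro cap_chart_rescale[symmetric]; simp)+
    ultimately show ?thesis by (auto simp: mem_cball_0)
  qed
  have "((\<lambda>\<rho>::real. \<rho>\<^sup>2 * t) \<longlongrightarrow> 0\<^sup>2 * t) (at_right 0)" by (intro tendsto_intros)
  then have ev: "\<forall>\<^sub>F \<rho> in at_right 0. \<rho>\<^sup>2 * t < \<theta>" using \<theta>(1) by (auto dest: order_tendstoD(2))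
  have "\<forall>\<^sub>F \<rho> in at_right 0. \<forall>x\<in>E. \<forall>y\<in>E. (2 * a - norm (x - y)) / \<rho>\<^sup>2 \<le> t \<longrightarrow>
      (\<exists>u\<in>cball 0 R. \<exists>v\<in>cball 0 R. {x, y} = {cap_chart a (- 1) \<rho> u, cap_chart a 1 \<rho> v})"
    using ev eventually_at_right_less[of "0::real"]
  proof eventually_elim
    case (elim \<rho>)
    show ?case
    proof (intro ballI impI)
      fix x y assume xy: "x \<in> E" "y \<in> E" and t: "(2 * a - norm (x - y)) / \<rho>\<^sup>2 \<le> t"
      then have "2 * a - norm (x - y) < \<theta>" using elim by (simp add: divide_le_eq mult.commute)
      from \<theta>(2)[OF xy this]
      show "\<exists>u\<in>cball 0 R. \<exists>v\<in>cball 0 R. {x, y} = {cap_chart a (- 1) \<rho> u, cap_chart a 1 \<rho> v}"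
      proof
        assume "x \<in> ball (- a, 0) r \<and> y \<in> ball (a, 0) r"
        with window[of \<rho> x y] elim xy t show ?thesis by blast
      next
        assume "y \<in> ball (- a, 0) r \<and> x \<in> ball (a, 0) r"
        with window[of \<rho> y x] elim xy t show ?thesis by (auto simp: norm_minus_commute insert_commute)
      qed
    qed
  qed
  then show thesis by (rule that)
qed

text \<open>Tightness on the limit side: for points of the paraboloids the curvature bound gives |u
  - v|^2 \<le> 4a\<eta>h with h the total height, so \<open>pair_value\<close> is at least (1 -
  \<eta>)h.\<close>

lemma paraboloid_pair_in_window:
  assumes a: "a > 0" and \<eta>: "0 < \<eta>" "\<eta> < 1"
    and curv: "\<And>u v. (norm (u - v))\<^sup>2 \<le> 2 * a * \<eta> * (u \<bullet> (Hl *v u) + v \<bullet> (Hr *v v))"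
    and x: "x \<in> paraboloid Hl" and y: "y \<in> paraboloid Hr"
  shows "0 \<le> pair_value a x y"
    and "pair_value a x y \<le> t \<Longrightarrow> norm x \<le> t / (1 - \<eta>) + sqrt (4 * a * \<eta> * (t / (1 - \<eta>))) \<and>
          norm y \<le> t / (1 - \<eta>) + sqrt (4 * a * \<eta> * (t / (1 - \<eta>)))"
proof -
  have x': "snd x \<bullet> (Hl *v snd x) \<le> 2 * fst x" using x by (auto simp: paraboloid_def)
  have y': "snd y \<bullet> (Hr *v snd y) \<le> 2 * fst y" using y by (auto simp: paraboloid_def)
  have k: "(norm (u - v))\<^sup>2 \<le> 4 * a * \<eta> * h" if "u \<bullet> (Hl *v u) + v \<bullet> (Hr *v v) \<le> 2 * h" for u v h
  proof -
    note curv[of u v]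
    also have "2 * a * \<eta> * (u \<bullet> (Hl *v u) + v \<bullet> (Hr *v v)) \<le> 2 * a * \<eta> * (2 * h)"
      using a \<eta> that by (intro mult_left_mono) auto
    also have "\<dots> = 4 * a * \<eta> * h" by simp
    finally show ?thesis .
  qed
  \<comment> \<open>Setting one vector to 0 bounds each transversal part by its own height, and
    thereby forces the heights to be nonnegative.\<close>
  have nx: "(norm (snd x))\<^sup>2 \<le> 4 * a * \<eta> * fst x" using k[of "snd x" 0] x' by simp
  have ny: "(norm (snd y))\<^sup>2 \<le> 4 * a * \<eta> * fst y" using k[of 0 "snd y"] y' by simp
  have fx: "0 \<le> fst x" using order_trans[OF zero_le_power2 nx] a \<eta>
    by (metis mult_le_cancel_left_pos mult_pos_pos mult_zero_right zero_less_numeral)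
  have fy: "0 \<le> fst y" using order_trans[OF zero_le_power2 ny] a \<eta>
    by (metis mult_le_cancel_left_pos mult_pos_pos mult_zero_right zero_less_numeral)
  have "(norm (snd x - snd y))\<^sup>2 \<le> 4 * a * \<eta> * (fst x + fst y)" using k x' y' by simp
  then have "1 / (4 * a) * (norm (snd x - snd y))\<^sup>2 \<le> \<eta> * (fst x + fst y)"
    using a by (simp add: field_simps)
  then have *: "(1 - \<eta>) * (fst x + fst y) \<le> pair_value a x y"
    by (simp add: pair_value_def algebra_simps)
  show "0 \<le> pair_value a x y"
    using order_trans[OF _ *] fx fy \<eta> by simp
  assume "pair_value a x y \<le> t"
  with * have "fst x + fst y \<le> t / (1 - \<eta>)" using \<eta> by (simp add: field_simps)
  then show "norm x \<le> t / (1 - \<eta>) + sqrt (4 * a * \<eta> * (t / (1 - \<eta>))) \<and>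
          norm y \<le> t / (1 - \<eta>) + sqrt (4 * a * \<eta> * (t / (1 - \<eta>)))"
    using fx fy nx ny a \<eta> by (intro conjI norm_le_height_bound) auto
qed

section \<open>Expansion of the distance at the scale of the caps\<close>

text \<open>Difference of squares: with g the pair value, (2a - L)(2a + L) = \<rho>^2 (4ag -
  \<rho>^2 s^2). On the window 2a - L is itself of order \<rho>^2, so replacing 2a + L by 4a costs
  only a further \<rho>^2.\<close>

lemma scaled_deficit_approx:
  assumes a: "a > 0" and e: "e > 0"
  shows "\<forall>\<^sub>F \<rho> in at_right 0. \<forall>x\<in>cball 0 R. \<forall>y\<in>cball 0 R.
    \<bar>(2 * a - norm (cap_chart a (- 1) \<rho> x - cap_chart a 1 \<rho> y)) / \<rho>\<^sup>2 - pair_value a x y\<bar> \<le> e"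
proof -
  \<comment> \<open>\<open>G\<close> bounds |g| on the window, since |s| \<le> 2R and q/(4a) \<le>
    R^2/a. \<open>K\<close> collects the two error terms of order \<rho>^2, with 2a as a lower bound
    for the denominator 2a + L.\<close>
  define G where "G = 2 * R + R\<^sup>2 / a"
  define K where "K = (G * (4 * a * G + 4 * R\<^sup>2) / (2 * a) + 4 * R\<^sup>2) / (2 * a)"
  have main: "\<bar>(2 * a - norm (cap_chart a (- 1) \<rho> x - cap_chart a 1 \<rho> y)) / \<rho>\<^sup>2 - pair_value a x y\<bar> \<le> \<rho>\<^sup>2 * K"
    if \<rho>: "0 < \<rho>" "\<rho> < 1" and x: "norm x \<le> R" and y: "norm y \<le> R" for \<rho> x y
  proof -
    define s where "s = fst x + fst y"
    define q where "q = (norm (snd x - snd y))\<^sup>2"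
    define g where "g = pair_value a x y"
    define L where "L = norm (cap_chart a (- 1) \<rho> x - cap_chart a 1 \<rho> y)"
    have "\<bar>fst x\<bar> \<le> R" "\<bar>fst y\<bar> \<le> R" "norm (snd x) \<le> R" "norm (snd y) \<le> R"
      using x y norm_fst_le[of "fst x" "snd x"] norm_snd_le[of "snd x" "fst x"]
        norm_fst_le[of "fst y" "snd y"] norm_snd_le[of "snd y" "fst y"] by auto
    then have s: "\<bar>s\<bar> \<le> 2 * R" and nq: "norm (snd x - snd y) \<le> 2 * R"
      using norm_triangle_ineq4[of "snd x" "snd y"] by (auto simp: s_def)
    have s2: "s\<^sup>2 \<le> 4 * R\<^sup>2" using power_mono[OF s, of 2] by (simp add: power_mult_distrib)
    have q: "0 \<le> q" "q \<le> 4 * R\<^sup>2"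
      using power_mono[OF nq, of 2] by (auto simp: power_mult_distrib q_def)
    have g: "4 * a * g = 4 * a * s - q" using a by (simp add: g_def pair_value_def s_def q_def field_simps)
    have "g = s - q / (4 * a)" by (simp add: g_def pair_value_def s_def q_def)
    moreover have "q / (4 * a) \<le> R\<^sup>2 / a" using q a by (simp add: field_simps)
    moreover have "0 \<le> q / (4 * a)" using q a by simp
    ultimately have G: "\<bar>g\<bar> \<le> G" using s by (simp add: G_def)
    have L2: "L\<^sup>2 = (2 * a - \<rho>\<^sup>2 * s)\<^sup>2 + \<rho>\<^sup>2 * q"
    proof -
      have "L\<^sup>2 = (2 * a - \<rho>\<^sup>2 * s)\<^sup>2 + (norm (\<rho> *\<^sub>R (snd x - snd y)))\<^sup>2"
        unfolding L_def norm_Pair_sq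
        by (simp add: cap_chart_def s_def scaleR_diff_right power2_eq_square algebra_simps)
      then show ?thesis by (simp add: q_def power_mult_distrib)
    qed
    have L0: "0 \<le> L" by (simp add: L_def)
    then have pos: "2 * a + L > 0" using a by simp
    define k where "k = 4 * a * g - \<rho>\<^sup>2 * s\<^sup>2"
    have "(2 * a - L) * (2 * a + L) = \<rho>\<^sup>2 * k"
      using L2 unfolding k_def g by (simp add: power2_eq_square algebra_simps)
    then have dL: "2 * a - L = \<rho>\<^sup>2 * k / (2 * a + L)" using pos by (simp add: field_simps)
    then have D: "(2 * a - L) / \<rho>\<^sup>2 = k / (2 * a + L)" using \<rho> by simp
    have \<rho>1: "\<rho>\<^sup>2 \<le> 1" using \<rho> by (simp add: power_le_one)
    have \<rho>s: "\<rho>\<^sup>2 * s\<^sup>2 \<le> s\<^sup>2" "0 \<le> \<rho>\<^sup>2 * s\<^sup>2" using \<rho>1 by (auto simp: mult_left_le_one_le)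
    have kb: "\<bar>k\<bar> \<le> 4 * a * G + 4 * R\<^sup>2"
    proof -
      have "\<bar>k\<bar> \<le> \<bar>4 * a * g\<bar> + \<bar>\<rho>\<^sup>2 * s\<^sup>2\<bar>" unfolding k_def by (rule abs_triangle_ineq4)
      moreover have "\<bar>4 * a * g\<bar> \<le> 4 * a * G" using G a by (simp add: abs_mult)
      ultimately show ?thesis using \<rho>s s2 by simp
    qed
    have k0: "0 \<le> 4 * a * G + 4 * R\<^sup>2" using kb by linarith
    have "\<bar>2 * a - L\<bar> \<le> \<rho>\<^sup>2 * ((4 * a * G + 4 * R\<^sup>2) / (2 * a))"
      unfolding dL using kb k0 L0 a pos
      by (simp add: abs_mult) (intro mult_left_mono frac_le; simp)
    then have "\<bar>g\<bar> * \<bar>2 * a - L\<bar> \<le> G * (\<rho>\<^sup>2 * ((4 * a * G + 4 * R\<^sup>2) / (2 * a)))"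
      using G by (intro mult_mono) auto
    moreover have "\<bar>\<rho>\<^sup>2 * s\<^sup>2\<bar> \<le> \<rho>\<^sup>2 * (4 * R\<^sup>2)" using s2 by (simp add: abs_mult mult_left_mono)
    ultimately have "\<bar>g * (2 * a - L) - \<rho>\<^sup>2 * s\<^sup>2\<bar>
        \<le> G * (\<rho>\<^sup>2 * ((4 * a * G + 4 * R\<^sup>2) / (2 * a))) + \<rho>\<^sup>2 * (4 * R\<^sup>2)"
      using abs_triangle_ineq4[of "g * (2 * a - L)" "\<rho>\<^sup>2 * s\<^sup>2"] unfolding abs_mult[of g] by linarith
    also have "\<dots> = \<rho>\<^sup>2 * (G * (4 * a * G + 4 * R\<^sup>2) / (2 * a) + 4 * R\<^sup>2)"
      by (simp add: algebra_simps)
    finally have num: "\<bar>g * (2 * a - L) - \<rho>\<^sup>2 * s\<^sup>2\<bar> \<le> \<rho>\<^sup>2 * (G * (4 * a * G + 4 * R\<^sup>2) / (2 * a) + 4 * R\<^sup>2)" .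
    \<comment> \<open>Writing 4ag as g(2a + L) + g(2a - L) isolates the error.\<close>
    have "(2 * a - L) / \<rho>\<^sup>2 - g = (g * (2 * a - L) - \<rho>\<^sup>2 * s\<^sup>2) / (2 * a + L)"
      unfolding D using pos by (simp add: k_def field_simps)
    also have "\<bar>\<dots>\<bar> \<le> (\<rho>\<^sup>2 * (G * (4 * a * G + 4 * R\<^sup>2) / (2 * a) + 4 * R\<^sup>2)) / (2 * a)"
      using num L0 a order_trans[OF abs_ge_zero num] unfolding abs_divide by (intro frac_le) auto
    finally show ?thesis by (simp add: L_def g_def K_def)
  qed
  have "((\<lambda>\<rho>::real. \<rho>\<^sup>2 * K) \<longlongrightarrow> 0\<^sup>2 * K) (at_right 0)" by (intro tendsto_intros)
  then have "\<forall>\<^sub>F \<rho> in at_right 0. \<rho>\<^sup>2 * K < e" using e by (auto dest: order_tendstoD(2))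
  moreover have "\<forall>\<^sub>F \<rho> in at_right 0. \<rho> < (1::real)" by (auto intro: eventually_at_rightI[of 0 1])
  ultimately show ?thesis
    using eventually_at_right_less[of "0::real"]
    by eventually_elim (use main in \<open>force simp: mem_cball_0\<close>)
qed

subsection \<open>Convergence of the intensities\<close>

lemma cap_chart_measurable [measurable]: "cap_chart a \<sigma> \<rho> \<in> borel_measurable borel"
  unfolding cap_chart_def[abs_def]
  by (intro borel_measurable_continuous_onI continuous_intros)

lemma cap_rescale_measurable [measurable]: "cap_rescale a \<sigma> \<rho> \<in> borel_measurable borel"
  unfolding cap_rescale_def[abs_def] divide_inverse
  by (intro borel_measurable_continuous_onI continuous_intros)

lemma paraboloid_measurable [measurable]:
  fixes H :: "real^'n^'n"
  shows "paraboloid H \<in> sets borel"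
proof -
  have "closed {z :: real \<times> (real^'n). (1/2) * (snd z \<bullet> (H *v snd z)) \<le> fst z}"
    by (intro closed_Collect_le continuous_intros
        continuous_on_compose2[OF matrix_vector_mult_linear_continuous_on[of UNIV]]) auto
  moreover have "paraboloid H = {z. (1/2) * (snd z \<bullet> (H *v snd z)) \<le> fst z}"
    by (auto simp: paraboloid_def)
  ultimately show ?thesis by simp
qed

text \<open>The chart is a map diagonal in the standard basis followed by a translation, so the
  Jacobian is a product of one factor \<rho>^2 for the axis and CARD('n) factors \<rho>; the sign
  \<sigma> disappears in absolute value.\<close>

lemma nn_integral_cap_chart:
  fixes g :: "real \<times> (real^'n) \<Rightarrow> ennreal"
  assumes \<sigma>: "\<sigma> \<in> {-1, 1}" and \<rho>: "\<rho> > 0" and [measurable]: "g \<in> borel_measurable borel"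
  shows "(\<integral>\<^sup>+z. g z \<partial>lborel) = ennreal (\<rho> ^ (CARD('n) + 2)) * (\<integral>\<^sup>+x. g (cap_chart a \<sigma> \<rho> x) \<partial>lborel)"
proof -
  define c :: "real \<times> (real^'n) \<Rightarrow> real" where "c j = (if j = (1, 0) then - \<sigma> * \<rho>\<^sup>2 else \<rho>)" for j
  define T where "T x = (\<sigma> * a, 0) + (\<Sum>j\<in>Basis. (c j * (x \<bullet> j)) *\<^sub>R j)" for x :: "real \<times> (real^'n)"
  have c: "c j \<noteq> 0" for j using \<sigma> \<rho> by (auto simp: c_def)
  have c1: "c (1, 0) = - \<sigma> * \<rho>\<^sup>2" by (simp add: c_def)
  have c2: "c (0, b) = \<rho>" for b by (simp add: c_def)
  have T: "T x = cap_chart a \<sigma> \<rho> x" for x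
  proof -
    have "(\<Sum>j\<in>Basis. (c j * (x \<bullet> j)) *\<^sub>R j)
      = (- \<sigma> * \<rho>\<^sup>2 * fst x, 0) + (\<Sum>b\<in>Basis. (0, (\<rho> * (snd x \<bullet> b)) *\<^sub>R b))"
      by (cases x) (simp add: sum_Basis_prod_eq c1 c2)
    also have "(\<Sum>b\<in>Basis. (0 :: real, (\<rho> * (snd x \<bullet> b)) *\<^sub>R b)) = (0, \<rho> *\<^sub>R (\<Sum>b\<in>Basis. (snd x \<bullet> b) *\<^sub>R b))"
      by (simp add: sum_prod scaleR_sum_right)
    finally show ?thesis
      by (simp add: T_def cap_chart_def euclidean_representation algebra_simps)
  qed
  have "(\<Prod>j\<in>Basis. \<bar>c j\<bar>) = \<bar>c (1, 0)\<bar> * (\<Prod>b\<in>(Basis :: (real^'n) set). \<bar>c (0, b)\<bar>)"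
    unfolding Basis_prod_def
    by (subst prod.union_disjoint) (auto simp: prod.reindex inj_on_def)
  also have "\<dots> = \<rho>\<^sup>2 * \<rho> ^ CARD('n)"
    using \<sigma> \<rho> unfolding c1 c2 by (auto simp: abs_mult)
  finally have P: "(\<Prod>j\<in>Basis. \<bar>c j\<bar>) = \<rho> ^ (CARD('n) + 2)"
    by (simp add: power_add mult_ac power2_eq_square)
  have "lborel = density (distr lborel borel T) (\<lambda>_. ennreal (\<rho> ^ (CARD('n) + 2)))"
    using lborel_affine_euclidean[of c "(\<sigma> * a, 0)"] c unfolding P T_def[abs_def] by simp
  then have "(\<integral>\<^sup>+z. g z \<partial>lborel) = (\<integral>\<^sup>+z. g z \<partial>density (distr lborel borel T) (\<lambda>_. ennreal (\<rho> ^ (CARD('n) + 2))))"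
    by metis
  also have "\<dots> = ennreal (\<rho> ^ (CARD('n) + 2)) * (\<integral>\<^sup>+x. g (T x) \<partial>lborel)"
    unfolding T[abs_def] by (simp add: nn_integral_density nn_integral_distr nn_integral_cmult)
  finally show ?thesis by (simp add: T)
qed

text \<open>By Fubini, as each line parallel to the axis meets the boundary in one point. Boundary
  points are set aside because their membership in \<open>E\<close> need not stabilise under
  scaling.\<close>

lemma AE_not_on_paraboloid_boundary:
  fixes H :: "real^'n^'n"
  shows "AE x in lborel. fst x \<noteq> (snd x \<bullet> (H *v snd x)) / 2"
proof -
  have [measurable]: "(\<lambda>w. w \<bullet> (H *v w)) \<in> borel_measurable borel"
    by (intro borel_measurable_continuous_onI continuous_intros)
  have m: "{x \<in> space (lborel \<Otimes>\<^sub>M lborel). fst x \<noteq> (snd x \<bullet> (H *v snd x)) / 2} \<in> sets (lborel \<Otimes>\<^sub>M lborel)"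
    by measurable
  have "AE w in lborel. AE x1 in lborel. x1 \<noteq> (w \<bullet> (H *v w)) / 2"
    by (intro AE_I2 AE_lborel_singleton)
  then have "AE x1 in lborel. AE w in lborel. x1 \<noteq> (w \<bullet> (H *v w)) / 2"
    by (rule iffD2[OF lborel_pair.AE_commute, OF m])
  then have "AE x in lborel \<Otimes>\<^sub>M lborel. fst x \<noteq> (snd x \<bullet> (H *v snd x)) / 2"
    by (intro lborel_pair.AE_pair_measure m) (simp only: fst_conv snd_conv)
  then show ?thesis unfolding lborel_prod .
qed

lemma dist_cap_chart_pole:
  assumes "\<sigma> \<in> {-1, 1}" "0 \<le> \<rho>"
  shows "dist (cap_chart a \<sigma> \<rho> x) (\<sigma> * a, 0) \<le> (\<rho>\<^sup>2 + \<rho>) * norm x"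
proof -
  have "dist (cap_chart a \<sigma> \<rho> x) (\<sigma> * a, 0) = norm (- \<sigma> * \<rho>\<^sup>2 * fst x, \<rho> *\<^sub>R snd x)"
    by (simp add: dist_norm cap_chart_def algebra_simps)
  also have "\<dots> \<le> norm (- \<sigma> * \<rho>\<^sup>2 * fst x) + norm (\<rho> *\<^sub>R snd x)"
    by (rule norm_Pair_le)
  also have "\<dots> = \<rho>\<^sup>2 * norm (fst x) + \<rho> * norm (snd x)"
    using assms by (auto simp: abs_mult)
  also have "\<dots> \<le> \<rho>\<^sup>2 * norm x + \<rho> * norm x"
    using assms norm_fst_le[of "fst x" "snd x"] norm_snd_le[of "snd x" "fst x"]
    by (intro add_mono mult_left_mono) auto
  finally show ?thesis by (simp add: algebra_simps)
qed

text \<open>Off the boundary the height differs from half the Hessian form by \<open>gap\<close>.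
  Under scaling this difference and the Taylor error both carry the factor \<rho>^2, so an error
  below \<open>gap\<close> decides membership in \<open>E\<close> for all small \<rho>. Continuity
  of \<open>f\<close> within \<open>E\<close> does the rest.\<close>

lemma tendsto_cap_density:
  fixes E :: "(real \<times> (real^'n)) set" and f :: "real \<times> (real^'n) \<Rightarrow> real"
  assumes cap: "pole_cap a E \<sigma> s" and f: "continuous (at (\<sigma> * a, 0) within E) f"
    and \<rho>: "\<And>n. \<rho> n > 0" "\<rho> \<longlonglongrightarrow> 0"
    and x: "fst x \<noteq> (snd x \<bullet> (hessian s 0 *v snd x)) / 2"
  shows "(\<lambda>n. indicator E (cap_chart a \<sigma> (\<rho> n) x) * f (cap_chart a \<sigma> (\<rho> n) x))
    \<longlonglongrightarrow> indicator (paraboloid (hessian s 0)) x * f (\<sigma> * a, 0)"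
proof -
  define w where "w = snd x"
  define Q where "Q = w \<bullet> (hessian s 0 *v w)"
  define gap where "gap = \<bar>fst x - Q / 2\<bar>"
  have \<sigma>: "\<sigma> \<in> {-1, 1}" using cap by (simp add: pole_cap_def)
  have gap: "gap > 0" using x by (simp add: gap_def Q_def w_def)
  \<comment> \<open>Half the gap is spread over |w|^2 + 1; the added 1 covers the case w =
    0.\<close>
  define e where "e = gap / (2 * ((norm w)\<^sup>2 + 1))"
  have w1: "(norm w)\<^sup>2 + 1 > 0" by (rule add_nonneg_pos) auto
  have e: "e > 0" using gap w1 by (simp add: e_def)
  have ew: "e * (norm w)\<^sup>2 < gap"
  proof -
    have "e * (norm w)\<^sup>2 \<le> e * ((norm w)\<^sup>2 + 1)" using e by simp
    also have "\<dots> = gap / 2" using w1 by (simp add: e_def field_simps)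
    finally show ?thesis using gap by simp
  qed
  obtain r where r: "r > 0"
    "\<And>z. dist z (\<sigma> * a, 0) < r \<Longrightarrow> z \<in> E \<longleftrightarrow> s (snd z) \<le> a - \<sigma> * fst z"
    "\<And>z. dist z (\<sigma> * a, 0) < r \<Longrightarrow> \<bar>s (snd z) - (snd z \<bullet> (hessian s 0 *v snd z)) / 2\<bar> \<le> e * (norm (snd z))\<^sup>2"
    using pole_cap_local[OF cap e] by blast
  define z where "z n = cap_chart a \<sigma> (\<rho> n) x" for n
  have "(\<lambda>n. ((\<rho> n)\<^sup>2 + \<rho> n) * norm x) \<longlonglongrightarrow> (0\<^sup>2 + 0) * norm x"
    by (intro tendsto_intros \<rho>)
  then have lim0: "(\<lambda>n. ((\<rho> n)\<^sup>2 + \<rho> n) * norm x) \<longlonglongrightarrow> 0" by simp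
  have near: "\<forall>\<^sub>F n in sequentially. dist (z n) (\<sigma> * a, 0) < d" if "d > 0" for d
    using order_tendstoD(2)[OF lim0 that]
  proof eventually_elim
    case (elim n)
    with dist_cap_chart_pole[OF \<sigma> less_imp_le[OF \<rho>(1)[of n]], of a x] show ?case by (simp add: z_def)
  qed
  have mem: "z n \<in> E \<longleftrightarrow> x \<in> paraboloid (hessian s 0)" if "dist (z n) (\<sigma> * a, 0) < r" for n
  proof -
    have snd: "snd (z n) = \<rho> n *\<^sub>R w" by (simp add: z_def cap_chart_def w_def)
    have height: "a - \<sigma> * fst (z n) = (\<rho> n)\<^sup>2 * fst x" using \<sigma> by (auto simp: z_def cap_chart_def)
    have "snd (z n) \<bullet> (hessian s 0 *v snd (z n)) = (\<rho> n)\<^sup>2 * Q"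
      unfolding snd Q_def by (simp add: matrix_vector_mult_scaleR power2_eq_square)
    moreover have "e * (norm (snd (z n)))\<^sup>2 = (\<rho> n)\<^sup>2 * (e * (norm w)\<^sup>2)"
      by (simp add: snd power_mult_distrib)
    ultimately have "\<bar>s (snd (z n)) - (\<rho> n)\<^sup>2 * Q / 2\<bar> \<le> (\<rho> n)\<^sup>2 * (e * (norm w)\<^sup>2)"
      using r(3)[OF that] by (simp only:)
    moreover have "(\<rho> n)\<^sup>2 * (e * (norm w)\<^sup>2) < (\<rho> n)\<^sup>2 * gap" using ew \<rho>(1)[of n] by simp
    ultimately have close: "\<bar>s (snd (z n)) - (\<rho> n)\<^sup>2 * Q / 2\<bar> < (\<rho> n)\<^sup>2 * gap" by linarith
    have "z n \<in> E \<longleftrightarrow> s (snd (z n)) \<le> (\<rho> n)\<^sup>2 * fst x" using r(2)[OF that] height by simp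
    also have "\<dots> \<longleftrightarrow> Q / 2 \<le> fst x"
    proof (cases "Q / 2 \<le> fst x")
      case True
      then have "(\<rho> n)\<^sup>2 * gap = (\<rho> n)\<^sup>2 * fst x - (\<rho> n)\<^sup>2 * Q / 2" by (simp add: gap_def algebra_simps)
      with close True show ?thesis by linarith
    next
      case False
      then have "(\<rho> n)\<^sup>2 * gap = (\<rho> n)\<^sup>2 * Q / 2 - (\<rho> n)\<^sup>2 * fst x" by (simp add: gap_def algebra_simps)
      with close False show ?thesis by linarith
    qed
    also have "\<dots> \<longleftrightarrow> x \<in> paraboloid (hessian s 0)"
      by (cases x) (auto simp: paraboloid_def Q_def w_def)
    finally show ?thesis .
  qed
  show ?thesis
  proof (cases "x \<in> paraboloid (hessian s 0)")
    case True
    have "\<forall>\<^sub>F n in sequentially. dist (indicator E (z n) * f (z n)) (f (\<sigma> * a, 0)) < d" if d: "d > 0" for d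
    proof -
      obtain r' where r': "r' > 0" "\<And>y. y \<in> E \<Longrightarrow> dist y (\<sigma> * a, 0) < r' \<Longrightarrow> dist (f y) (f (\<sigma> * a, 0)) < d"
        using f[unfolded continuous_within_eps_delta, rule_format, OF d] by blast
      show ?thesis using near[OF r(1)] near[OF r'(1)]
      proof eventually_elim
        case (elim n)
        have "z n \<in> E" using mem[OF elim(1)] True by simp
        with r'(2)[OF this elim(2)] show ?case by simp
      qed
    qed
    then have "(\<lambda>n. indicator E (z n) * f (z n)) \<longlonglongrightarrow> f (\<sigma> * a, 0)" by (rule tendstoI)
    then show ?thesis using True by (simp add: z_def)
  next
    case False
    \<comment> \<open>Outside \<open>E\<close> nothing is known about \<open>f\<close>; the
      indicator alone makes the value 0.\<close>
    have "\<forall>\<^sub>F n in sequentially. indicator E (z n) * f (z n) = 0"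
      using near[OF r(1)]
    proof eventually_elim
      case (elim n)
      have "z n \<notin> E" using mem[OF elim] False by simp
      then show ?case by simp
    qed
    then have "(\<lambda>n. indicator E (z n) * f (z n)) \<longlonglongrightarrow> 0" by (rule tendsto_eventually)
    then show ?thesis using False by (simp add: z_def)
  qed
qed

text \<open>Dominated convergence: the bounded window is mapped ever closer to the pole, where
  continuity bounds \<open>f\<close> on \<open>E\<close> by p + 1, and a constant is integrable over
  a bounded set.\<close>

lemma cap_intensity_convergence:
  fixes E :: "(real \<times> (real^'n)) set"
  assumes cap: "pole_cap a E \<sigma> s" and f: "continuous (at (\<sigma> * a, 0) within E) f"
    and nn: "\<And>z. z \<in> E \<Longrightarrow> 0 \<le> f z"
    and meas [measurable]: "(\<lambda>z. ennreal (indicator E z * f z)) \<in> borel_measurable borel"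
    and \<rho>: "\<And>n. \<rho> n > 0" "\<rho> \<longlonglongrightarrow> 0"
    and A [measurable]: "A \<in> sets borel" and bA: "bounded A"
  shows "(\<lambda>n. \<integral>\<^sup>+x. ennreal (indicator E (cap_chart a \<sigma> (\<rho> n) x) * f (cap_chart a \<sigma> (\<rho> n) x)) * indicator A x \<partial>lborel)
    \<longlonglongrightarrow> emeasure (paraboloid_intensity (f (\<sigma> * a, 0)) (hessian s 0)) A"
proof -
  define p where "p = f (\<sigma> * a, 0)"
  define P where "P = paraboloid (hessian s 0)"
  have [measurable]: "P \<in> sets borel" unfolding P_def by simp
  define u where "u n x = ennreal (indicator E (cap_chart a \<sigma> (\<rho> n) x) * f (cap_chart a \<sigma> (\<rho> n) x)) * indicator A x" for n x
  have \<sigma>: "\<sigma> \<in> {-1, 1}" and pole: "(\<sigma> * a, 0) \<in> E" using cap by (auto simp: pole_cap_def)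
  have p0: "0 \<le> p" using nn[OF pole] by (simp add: p_def)
  have um [measurable]: "u n \<in> borel_measurable borel" for n
    unfolding u_def[abs_def]
    by (intro borel_measurable_times_ennreal measurable_compose[OF cap_chart_measurable meas]) simp
  obtain R where R: "\<And>x. x \<in> A \<Longrightarrow> norm x \<le> R" using bA by (auto simp: bounded_iff)
  obtain r where r: "r > 0" "\<And>y. y \<in> E \<Longrightarrow> dist y (\<sigma> * a, 0) < r \<Longrightarrow> dist (f y) p < 1"
    using f[unfolded continuous_within_eps_delta, rule_format, OF zero_less_one] unfolding p_def by blast
  have "(\<lambda>n. ((\<rho> n)\<^sup>2 + \<rho> n) * R) \<longlonglongrightarrow> (0\<^sup>2 + 0) * R"
    by (intro tendsto_intros \<rho>)
  then have "\<forall>\<^sub>F n in sequentially. ((\<rho> n)\<^sup>2 + \<rho> n) * R < r"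
    using r(1) by (auto dest: order_tendstoD(2))
  \<comment> \<open>The domination holds only from \<open>n0\<close> on, so the limit is taken along
    the shifted sequence.\<close>
  then obtain n0 where n0: "\<And>n. n \<ge> n0 \<Longrightarrow> ((\<rho> n)\<^sup>2 + \<rho> n) * R < r"
    by (auto simp: eventually_sequentially)
  have bound: "u (n + n0) x \<le> ennreal (p + 1) * indicator A x" for n x
  proof (cases "x \<in> A \<and> cap_chart a \<sigma> (\<rho> (n + n0)) x \<in> E")
    case True
    let ?\<rho> = "\<rho> (n + n0)"
    have "dist (cap_chart a \<sigma> ?\<rho> x) (\<sigma> * a, 0) \<le> (?\<rho>\<^sup>2 + ?\<rho>) * norm x"
      by (intro dist_cap_chart_pole[OF \<sigma>] less_imp_le \<rho>(1))
    also have "\<dots> \<le> (?\<rho>\<^sup>2 + ?\<rho>) * R"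
      using R True \<rho>(1)[of "n + n0"] by (intro mult_left_mono) (auto intro: less_imp_le)
    also have "\<dots> < r" using n0 by simp
    finally have "dist (f (cap_chart a \<sigma> ?\<rho> x)) p < 1" using r(2) True by blast
    then have "f (cap_chart a \<sigma> ?\<rho> x) \<le> p + 1" by (simp add: dist_real_def)
    then show ?thesis using True by (auto simp: u_def intro!: ennreal_leI)
  qed (auto simp: u_def)
  have pw: "AE x in lborel. (\<lambda>n. u (n + n0) x) \<longlonglongrightarrow> ennreal p * indicator P x * indicator A x"
    using AE_not_on_paraboloid_boundary[of "hessian s 0"]
  proof eventually_elim
    case (elim x)
    have "(\<lambda>n. ennreal (indicator E (cap_chart a \<sigma> (\<rho> n) x) * f (cap_chart a \<sigma> (\<rho> n) x)))
       \<longlonglongrightarrow> ennreal (indicator P x * p)"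
      unfolding P_def p_def by (intro tendsto_ennrealI tendsto_cap_density[OF cap f \<rho>] elim)
    then have "(\<lambda>n. u n x) \<longlonglongrightarrow> ennreal (indicator P x * p) * indicator A x"
      unfolding u_def by (cases "x \<in> A") auto
    then have "(\<lambda>n. u (n + n0) x) \<longlonglongrightarrow> ennreal (indicator P x * p) * indicator A x"
      by (rule LIMSEQ_ignore_initial_segment)
    then show ?case by (cases "x \<in> P") auto
  qed
  have "(\<integral>\<^sup>+x. ennreal (p + 1) * indicator A x \<partial>lborel) = ennreal (p + 1) * emeasure lborel A"
    by (simp add: nn_integral_cmult_indicator)
  also have "\<dots> < \<infinity>" using emeasure_bounded_finite[OF bA] by (simp add: ennreal_mult_less_top)
  finally have fin: "(\<integral>\<^sup>+x. ennreal (p + 1) * indicator A x \<partial>lborel) < \<infinity>" .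
  have "(\<lambda>n. \<integral>\<^sup>+x. u (n + n0) x \<partial>lborel) \<longlonglongrightarrow> (\<integral>\<^sup>+x. ennreal p * indicator P x * indicator A x \<partial>lborel)"
    by (rule nn_integral_dominated_convergence[OF _ _ _ _ fin pw]) (use bound in auto)
  then have "(\<lambda>n. \<integral>\<^sup>+x. u n x \<partial>lborel) \<longlonglongrightarrow> (\<integral>\<^sup>+x. ennreal p * indicator P x * indicator A x \<partial>lborel)"
    by (rule LIMSEQ_offset)
  also have "(\<integral>\<^sup>+x. ennreal p * indicator P x * indicator A x \<partial>lborel) = emeasure (paraboloid_intensity p (hessian s 0)) A"
    unfolding paraboloid_intensity_def P_def by (subst emeasure_density) auto
  finally show ?thesis by (simp add: u_def p_def)
qed

lemma emeasure_paraboloid_intensity_finite: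
  assumes "bounded A" and [measurable]: "A \<in> sets borel"
  shows "emeasure (paraboloid_intensity p H) A < \<infinity>"
proof -
  have "emeasure (paraboloid_intensity p H) A = (\<integral>\<^sup>+x. ennreal p * indicator (paraboloid H) x * indicator A x \<partial>lborel)"
    unfolding paraboloid_intensity_def by (subst emeasure_density) auto
  also have "\<dots> \<le> (\<integral>\<^sup>+x. ennreal p * indicator A x \<partial>lborel)"
    by (intro nn_integral_mono) (auto split: split_indicator)
  also have "\<dots> = ennreal p * emeasure lborel A" by (simp add: nn_integral_cmult_indicator)
  also have "\<dots> < \<infinity>" using emeasure_bounded_finite[OF assms(1)] by (simp add: ennreal_mult_less_top)
  finally show ?thesis .
qed

text \<open>The Jacobian \<rho>^(d+1) = 1/n of the chart cancels the factor \<open>n\<close>,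
  leaving the integral of the rescaled density over \<open>A\<close>.\<close>

lemma cap_hit_prob_convergence:
  fixes E :: "(real \<times> (real^'n)) set" and Z :: "'w \<Rightarrow> real \<times> (real^'n)"
  assumes cap: "pole_cap a E \<sigma> s" and f: "continuous (at (\<sigma> * a, 0) within E) f"
    and nn: "\<And>z. z \<in> E \<Longrightarrow> 0 \<le> f z"
    and Z: "distributed M lborel Z (\<lambda>z. ennreal (indicator E z * f z))"
    and \<rho>: "\<And>n. \<rho> n > 0" "\<rho> \<longlonglongrightarrow> 0" "\<And>n. n \<ge> 1 \<Longrightarrow> real n * \<rho> n ^ (CARD('n) + 2) = 1"
    and A [measurable]: "A \<in> sets borel" and bA: "bounded A"
  shows "(\<lambda>n. real n * measure M {\<omega> \<in> space M. cap_rescale a \<sigma> (\<rho> n) (Z \<omega>) \<in> A})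
    \<longlonglongrightarrow> measure (paraboloid_intensity (f (\<sigma> * a, 0)) (hessian s 0)) A"
proof -
  have \<sigma>: "\<sigma> \<in> {-1, 1}" using cap by (auto simp: pole_cap_def)
  have meas [measurable]: "(\<lambda>z. ennreal (indicator E z * f z)) \<in> borel_measurable borel"
    using distributed_borel_measurable[OF Z] by simp
  have Zm [measurable]: "Z \<in> borel_measurable M" using distributed_measurable[OF Z] by simp
  define I where "I n = (\<integral>\<^sup>+x. ennreal (indicator E (cap_chart a \<sigma> (\<rho> n) x) * f (cap_chart a \<sigma> (\<rho> n) x)) * indicator A x \<partial>lborel)" for n
  have em: "emeasure M {\<omega> \<in> space M. cap_rescale a \<sigma> (\<rho> n) (Z \<omega>) \<in> A} = ennreal (\<rho> n ^ (CARD('n) + 2)) * I n" for n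
  proof -
    let ?B = "{z. cap_rescale a \<sigma> (\<rho> n) z \<in> A}"
    have B [measurable]: "?B \<in> sets borel"
      using measurable_sets[OF cap_rescale_measurable A, of a \<sigma> "\<rho> n"] by (simp add: vimage_def)
    have ind: "indicator ?B (cap_chart a \<sigma> (\<rho> n) x) = (indicator A x :: ennreal)" for x
      by (simp add: indicator_def cap_rescale_chart[OF \<sigma> \<rho>(1)])
    have "emeasure M (Z -` ?B \<inter> space M) = (\<integral>\<^sup>+z. ennreal (indicator E z * f z) * indicator ?B z \<partial>lborel)"
      using B by (intro distributed_emeasure[OF Z]) simp
    also have "\<dots> = ennreal (\<rho> n ^ (CARD('n) + 2)) *
        (\<integral>\<^sup>+x. ennreal (indicator E (cap_chart a \<sigma> (\<rho> n) x) * f (cap_chart a \<sigma> (\<rho> n) x)) * indicator ?B (cap_chart a \<sigma> (\<rho> n) x) \<partial>lborel)"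
      by (rule nn_integral_cap_chart[OF \<sigma> \<rho>(1)]) measurable
    finally show ?thesis by (simp add: I_def ind vimage_def Collect_conj_eq Int_commute)
  qed
  have lim: "I \<longlonglongrightarrow> emeasure (paraboloid_intensity (f (\<sigma> * a, 0)) (hessian s 0)) A"
    unfolding I_def by (rule cap_intensity_convergence[OF cap f nn meas \<rho>(1,2) A bA])
  have "(\<lambda>n. enn2real (I n)) \<longlonglongrightarrow> measure (paraboloid_intensity (f (\<sigma> * a, 0)) (hessian s 0)) A"
  proof (rule tendsto_enn2real)
    have "emeasure (paraboloid_intensity (f (\<sigma> * a, 0)) (hessian s 0)) A
      = ennreal (measure (paraboloid_intensity (f (\<sigma> * a, 0)) (hessian s 0)) A)"
      using emeasure_paraboloid_intensity_finite[OF bA A, of "f (\<sigma> * a, 0)" "hessian s 0"]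
      by (intro emeasure_eq_ennreal_measure) (simp add: less_top)
    with lim show "I \<longlonglongrightarrow> ennreal (measure (paraboloid_intensity (f (\<sigma> * a, 0)) (hessian s 0)) A)"
      by simp
  qed simp
  moreover have "\<forall>\<^sub>F n in sequentially. enn2real (I n) = real n * measure M {\<omega> \<in> space M. cap_rescale a \<sigma> (\<rho> n) (Z \<omega>) \<in> A}"
    using eventually_ge_at_top[of 1]
  proof eventually_elim
    case (elim n)
    have "measure M {\<omega> \<in> space M. cap_rescale a \<sigma> (\<rho> n) (Z \<omega>) \<in> A} = \<rho> n ^ (CARD('n) + 2) * enn2real (I n)"
      unfolding measure_def em using \<rho>(1)[of n] by (simp add: enn2real_mult)
    then have "real n * measure M {\<omega> \<in> space M. cap_rescale a \<sigma> (\<rho> n) (Z \<omega>) \<in> A}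
      = (real n * \<rho> n ^ (CARD('n) + 2)) * enn2real (I n)" by simp
    with \<rho>(3)[OF elim] show ?case by simp
  qed
  ultimately show ?thesis by (rule Lim_transform_eventually)
qed

subsection \<open>Weak convergence from occupied cells\<close>

lemma max_dist_ge:
  assumes "i < m" "j < m"
  shows "norm (z i - z j) \<le> max_dist z m"
proof -
  have "{norm (z i - z j) | i j. i < m \<and> j < m} = (\<lambda>(i, j). norm (z i - z j)) ` ({..<m} \<times> {..<m})" by auto
  then have "finite {norm (z i - z j) | i j. i < m \<and> j < m}" by simp
  with assms show ?thesis unfolding max_dist_def by (auto intro!: Max_ge)
qed

lemma max_dist_attained:
  assumes "0 < m"
  obtains i j where "i < m" "j < m" "max_dist z m = norm (z i - z j)"
proof -
  have "{norm (z i - z j) | i j. i < m \<and> j < m} = (\<lambda>(i, j). norm (z i - z j)) ` ({..<m} \<times> {..<m})" by auto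
  then have "finite {norm (z i - z j) | i j. i < m \<and> j < m}" by simp
  moreover have "{norm (z i - z j) | i j. i < m \<and> j < m} \<noteq> {}" using assms by auto
  ultimately have "Max {norm (z i - z j) | i j. i < m \<and> j < m} \<in> {norm (z i - z j) | i j. i < m \<and> j < m}"
    by (rule Max_in)
  with assms that show thesis unfolding max_dist_def by auto
qed

lemma max_dist_measurable [measurable]:
  fixes Z :: "nat \<Rightarrow> 'w \<Rightarrow> 'a::{real_normed_vector, second_countable_topology}"
  assumes [measurable]: "\<And>i. Z i \<in> borel_measurable M" "K \<in> measurable M (count_space UNIV)"
  shows "(\<lambda>\<omega>. max_dist (\<lambda>i. Z i \<omega>) (K \<omega>)) \<in> borel_measurable M"
proof (rule borel_measurableI_le)
  fix t
  \<comment> \<open>An empty sample has \<open>max_dist\<close> 0 by convention and is split off;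
    otherwise the sublevel set is a countable conjunction over pairs of indices.\<close>
  have "max_dist (\<lambda>i. Z i \<omega>) (K \<omega>) \<le> t \<longleftrightarrow>
      (if K \<omega> = 0 then 0 \<le> t else \<forall>i j. i < K \<omega> \<and> j < K \<omega> \<longrightarrow> norm (Z i \<omega> - Z j \<omega>) \<le> t)" for \<omega>
  proof (cases "K \<omega> = 0")
    case False
    then have "0 < K \<omega>" by simp
    from max_dist_attained[OF this, of "\<lambda>i. Z i \<omega>"] show ?thesis
      using False max_dist_ge[of _ "K \<omega>" _ "\<lambda>i. Z i \<omega>"] by (smt (verit))
  qed (simp add: max_dist_def)
  then show "{\<omega> \<in> space M. max_dist (\<lambda>i. Z i \<omega>) (K \<omega>) \<le> t} \<in> sets M"
    by simp
qed

lemma cdf_distr_eq: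
  assumes "W \<in> borel_measurable M"
  shows "cdf (distr M borel W) t = measure M {\<omega> \<in> space M. W \<omega> \<le> t}"
  using assms unfolding cdf_def
  by (subst measure_distr) (auto intro!: arg_cong[of _ _ "measure M"])

section \<open>Discretisation of the windows into cells\<close>

text \<open>Heine-Cantor on a product of two compact balls. The bound \<epsilon> \<le> 1 ensures
  that cells centred in a ball of radius R stay in the ball of radius R + 1.\<close>

lemma pair_value_uniformly_close:
  fixes R :: real
  assumes "0 < \<delta>"
  obtains \<epsilon> where "0 < \<epsilon>" "\<epsilon> \<le> 1"
    "\<And>x y c c'. x \<in> cball 0 R \<Longrightarrow> y \<in> cball 0 R \<Longrightarrow> c \<in> cball 0 R \<Longrightarrow> c' \<in> cball 0 R \<Longrightarrow>
      dist x c < \<epsilon> \<Longrightarrow> dist y c' < \<epsilon> \<Longrightarrow> \<bar>pair_value a x y - pair_value a c (c' :: real \<times> (real^'n))\<bar> < \<delta>"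
proof -
  let ?S = "cball (0 :: real \<times> (real^'n)) R"
  have "continuous_on (?S \<times> ?S) (\<lambda>p. pair_value a (fst p) (snd p))"
    unfolding pair_value_def by (intro continuous_intros)
  then have "uniformly_continuous_on (?S \<times> ?S) (\<lambda>p. pair_value a (fst p) (snd p))"
    by (intro compact_uniformly_continuous compact_Times compact_cball)
  then obtain e where e: "e > 0" "\<And>p q. p \<in> ?S \<times> ?S \<Longrightarrow> q \<in> ?S \<times> ?S \<Longrightarrow> dist q p < e \<Longrightarrow>
      dist (pair_value a (fst q) (snd q)) (pair_value a (fst p) (snd p)) < \<delta>"
    unfolding uniformly_continuous_on_def using assms by meson
  show thesis
  proof (rule that[of "min (e / 2) 1"])
    fix x y c c' :: "real \<times> (real^'n)"
    assume *: "x \<in> ?S" "y \<in> ?S" "c \<in> ?S" "c' \<in> ?S" "dist x c < min (e / 2) 1" "dist y c' < min (e / 2) 1"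
    have "dist (x, y) (c, c') \<le> dist x c + dist y c'"
      unfolding dist_Pair_Pair by (intro sqrt_sum_squares_le_sum) auto
    with * have "dist (x, y) (c, c') < e" by simp
    with e(2)[of "(c, c')" "(x, y)"] * show "\<bar>pair_value a x y - pair_value a c c'\<bar> < \<delta>"
      by (simp add: dist_real_def)
  qed (use e in auto)
qed

text \<open>A common point would lie at distance less than \<open>a\<close> from both poles, which
  are 2a apart. Consequently the hitting probabilities of the two windows add up.\<close>

lemma cap_windows_disjoint:
  assumes a: "a > 0" and \<rho>: "\<And>n. \<rho> n > 0" "\<rho> \<longlonglongrightarrow> 0" and A: "bounded A" and B: "bounded B"
  shows "\<forall>\<^sub>F n in sequentially. \<forall>z. \<not> (cap_rescale a (- 1) (\<rho> n) z \<in> A \<and> cap_rescale a 1 (\<rho> n) z \<in> B)"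
proof -
  obtain R where R: "\<And>x. x \<in> A \<union> B \<Longrightarrow> norm x \<le> R"
    using A B bounded_Un[of A B] unfolding bounded_iff by blast
  have "(\<lambda>n. ((\<rho> n)\<^sup>2 + \<rho> n) * R) \<longlonglongrightarrow> (0\<^sup>2 + 0) * R"
    by (intro tendsto_intros \<rho>)
  then have "\<forall>\<^sub>F n in sequentially. ((\<rho> n)\<^sup>2 + \<rho> n) * R < a"
    using a by (auto dest: order_tendstoD(2))
  then show ?thesis
  proof eventually_elim
    case (elim n)
    show ?case
    proof (intro allI notI)
      fix z assume z: "cap_rescale a (- 1) (\<rho> n) z \<in> A \<and> cap_rescale a 1 (\<rho> n) z \<in> B"
      have d: "dist z (\<sigma> * a, 0) < a" if "\<sigma> \<in> {-1, 1}" "cap_rescale a \<sigma> (\<rho> n) z \<in> A \<union> B" for \<sigma>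
      proof -
        have "dist z (\<sigma> * a, 0) \<le> ((\<rho> n)\<^sup>2 + \<rho> n) * norm (cap_rescale a \<sigma> (\<rho> n) z)"
          using dist_cap_chart_pole[OF that(1) less_imp_le[OF \<rho>(1)], of a n "cap_rescale a \<sigma> (\<rho> n) z"]
          by (simp add: cap_chart_rescale[OF that(1) \<rho>(1)])
        also have "\<dots> \<le> ((\<rho> n)\<^sup>2 + \<rho> n) * R"
          using R[OF that(2)] \<rho>(1)[of n] by (intro mult_left_mono) (auto intro: less_imp_le)
        finally show ?thesis using elim by simp
      qed
      have "\<bar>fst z - (- 1) * a\<bar> < a"
        using d[of "- 1"] z dist_fst_le[of z "(- 1 * a, 0)"] by (simp add: dist_real_def)
      moreover have "\<bar>fst z - 1 * a\<bar> < a"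
        using d[of 1] z dist_fst_le[of z "(1 * a, 0)"] by (simp add: dist_real_def)
      ultimately show False by linarith
    qed
  qed
qed

text \<open>The windows at the two ends are pulled back to one set \<open>Bs n\<close> in the
  original space. Their preimages are disjoint for large \<open>n\<close>, so \<open>n\<close> times
  the mass of \<open>Bs n\<close> tends to the sum of the two intensities; the exponential of the
  sum is a product, which is how two independent processes arise from a single sample. The
  hypothesis \<open>void\<close> is the form in which both kinds of sample size are treated at
  once.\<close>

lemma cap_void_convergence:
  fixes Z :: "nat \<Rightarrow> 'w \<Rightarrow> real \<times> (real^'n)"
  assumes M: "prob_space M" and a: "a > 0"
    and Zm [measurable]: "\<And>i. Z i \<in> borel_measurable M"
    and void: "\<And>Bs c. (\<And>n. Bs n \<in> sets borel) \<Longrightarrow>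
       (\<lambda>n. real n * measure M {\<omega> \<in> space M. Z 0 \<omega> \<in> Bs n}) \<longlonglongrightarrow> c \<Longrightarrow>
       (\<lambda>n. measure M {\<omega> \<in> space M. \<forall>i<K n \<omega>. Z i \<omega> \<notin> Bs n}) \<longlonglongrightarrow> exp (- c)"
    and \<rho>: "\<And>n. \<rho> n > 0" "\<rho> \<longlonglongrightarrow> 0"
    and hits: "\<And>\<sigma> A. \<sigma> \<in> {-1, 1} \<Longrightarrow> A \<in> sets borel \<Longrightarrow> bounded A \<Longrightarrow>
       (\<lambda>n. real n * measure M {\<omega> \<in> space M. cap_rescale a \<sigma> (\<rho> n) (Z 0 \<omega>) \<in> A}) \<longlonglongrightarrow> \<Lambda> \<sigma> A"
    and A [measurable]: "A \<in> sets borel" "bounded A" and B [measurable]: "B \<in> sets borel" "bounded B"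
  shows "(\<lambda>n. measure M {\<omega> \<in> space M. \<forall>i<K n \<omega>. cap_rescale a (- 1) (\<rho> n) (Z i \<omega>) \<notin> A \<and> cap_rescale a 1 (\<rho> n) (Z i \<omega>) \<notin> B})
    \<longlonglongrightarrow> exp (- (\<Lambda> (- 1) A + \<Lambda> 1 B))"
proof -
  interpret prob_space M by fact
  define Bs where "Bs n = {z. cap_rescale a (- 1) (\<rho> n) z \<in> A \<or> cap_rescale a 1 (\<rho> n) z \<in> B}" for n
  have Bs: "Bs n \<in> sets borel" for n
  proof -
    have "Bs n = (cap_rescale a (- 1) (\<rho> n) -` A \<inter> space borel) \<union> (cap_rescale a 1 (\<rho> n) -` B \<inter> space borel)"
      by (auto simp: Bs_def)
    then show ?thesis using A B by (simp only:) (intro sets.Un measurable_sets[OF cap_rescale_measurable])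
  qed
  have "(\<lambda>n. real n * prob {\<omega> \<in> space M. cap_rescale a (- 1) (\<rho> n) (Z 0 \<omega>) \<in> A} +
             real n * prob {\<omega> \<in> space M. cap_rescale a 1 (\<rho> n) (Z 0 \<omega>) \<in> B}) \<longlonglongrightarrow> \<Lambda> (- 1) A + \<Lambda> 1 B"
    using A B by (intro tendsto_add hits) auto
  moreover have "\<forall>\<^sub>F n in sequentially. real n * prob {\<omega> \<in> space M. cap_rescale a (- 1) (\<rho> n) (Z 0 \<omega>) \<in> A} +
             real n * prob {\<omega> \<in> space M. cap_rescale a 1 (\<rho> n) (Z 0 \<omega>) \<in> B} = real n * prob {\<omega> \<in> space M. Z 0 \<omega> \<in> Bs n}"
    using cap_windows_disjoint[OF a \<rho> A(2) B(2)]
  proof eventually_elim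
    case (elim n)
    let ?l = "{\<omega> \<in> space M. cap_rescale a (- 1) (\<rho> n) (Z 0 \<omega>) \<in> A}"
    let ?r = "{\<omega> \<in> space M. cap_rescale a 1 (\<rho> n) (Z 0 \<omega>) \<in> B}"
    have "{\<omega> \<in> space M. Z 0 \<omega> \<in> Bs n} = ?l \<union> ?r" by (auto simp: Bs_def)
    moreover have "?l \<inter> ?r = {}" using elim by blast
    then have "prob (?l \<union> ?r) = prob ?l + prob ?r"
      by (intro finite_measure_Union) auto
    ultimately show ?case by (simp add: distrib_left)
  qed
  ultimately have "(\<lambda>n. real n * prob {\<omega> \<in> space M. Z 0 \<omega> \<in> Bs n}) \<longlonglongrightarrow> \<Lambda> (- 1) A + \<Lambda> 1 B"
    by (rule Lim_transform_eventually)
  from void[OF Bs this] show ?thesis by (simp add: Bs_def)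
qed

text \<open>The windows of sample and limit are covered by the same finitely many \<epsilon>-balls,
  used once at each end. The event that two occupied cells, one at each end, have centres of pair
  value at most t + 2\<delta> depends only on the set of occupied cells, so its probability
  converges by \<open>occupancy_convergence\<close>. Up to null sets, and for large \<open>n\<close>
  on the sample side, it lies between the events of level t and of level t + 4\<delta>.\<close>

lemma occupied_cells_sandwich:
  fixes Z :: "nat \<Rightarrow> 'w \<Rightarrow> real \<times> (real^'n)" and X Y :: "nat \<Rightarrow> 'v \<Rightarrow> real \<times> (real^'n)"
  assumes M: "prob_space M" and M': "prob_space M'" and a: "a > 0"
    and Zm [measurable]: "\<And>i. Z i \<in> borel_measurable M" and ZE: "\<And>i. AE \<omega> in M. Z i \<omega> \<in> E"
    and Km [measurable]: "\<And>n. K n \<in> measurable M (count_space UNIV)"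
    and void: "\<And>Bs c. (\<And>n. Bs n \<in> sets borel) \<Longrightarrow>
       (\<lambda>n. real n * measure M {\<omega> \<in> space M. Z 0 \<omega> \<in> Bs n}) \<longlonglongrightarrow> c \<Longrightarrow>
       (\<lambda>n. measure M {\<omega> \<in> space M. \<forall>i<K n \<omega>. Z i \<omega> \<notin> Bs n}) \<longlonglongrightarrow> exp (- c)"
    and \<rho>: "\<And>n. \<rho> n > 0" "\<rho> \<longlonglongrightarrow> 0"
    and hits: "\<And>\<sigma> A. \<sigma> \<in> {-1, 1} \<Longrightarrow> A \<in> sets borel \<Longrightarrow> bounded A \<Longrightarrow>
       (\<lambda>n. real n * measure M {\<omega> \<in> space M. cap_rescale a \<sigma> (\<rho> n) (Z 0 \<omega>) \<in> A}) \<longlonglongrightarrow> \<Lambda> \<sigma> A"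
    and far: "\<And>t. \<exists>R. \<forall>\<^sub>F \<rho> in at_right 0. \<forall>x\<in>E. \<forall>y\<in>E. (2 * a - norm (x - y)) / \<rho>\<^sup>2 \<le> t \<longrightarrow>
      (\<exists>u\<in>cball 0 R. \<exists>v\<in>cball 0 R. {x, y} = {cap_chart a (- 1) \<rho> u, cap_chart a 1 \<rho> v})"
    and Xm [measurable]: "\<And>i. X i \<in> borel_measurable M'" and Ym [measurable]: "\<And>i. Y i \<in> borel_measurable M'"
    and void': "\<And>A B. A \<in> sets borel \<Longrightarrow> bounded A \<Longrightarrow> B \<in> sets borel \<Longrightarrow> bounded B \<Longrightarrow>
       measure M' {\<omega> \<in> space M'. (\<forall>i. X i \<omega> \<notin> A) \<and> (\<forall>i. Y i \<omega> \<notin> B)} = exp (- (\<Lambda> (- 1) A + \<Lambda> 1 B))"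
    and W [measurable]: "W \<in> borel_measurable M'"
    and attained: "AE \<omega> in M'. (\<forall>i j. W \<omega> \<le> pair_value a (X i \<omega>) (Y j \<omega>)) \<and> (\<exists>i j. pair_value a (X i \<omega>) (Y j \<omega>) = W \<omega>)"
    and window: "\<And>t. \<exists>R. AE \<omega> in M'. \<forall>i j. pair_value a (X i \<omega>) (Y j \<omega>) \<le> t \<longrightarrow> X i \<omega> \<in> cball 0 R \<and> Y j \<omega> \<in> cball 0 R"
    and \<delta>: "\<delta> > 0"
  defines "D n \<omega> \<equiv> (2 * a - max_dist (\<lambda>i. Z i \<omega>) (K n \<omega>)) / (\<rho> n)\<^sup>2"
  obtains b L where "b \<longlonglongrightarrow> L"
    "\<forall>\<^sub>F n in sequentially. measure M {\<omega> \<in> space M. D n \<omega> \<le> t} \<le> b n"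
    "\<forall>\<^sub>F n in sequentially. b n \<le> measure M {\<omega> \<in> space M. D n \<omega> \<le> t + 4 * \<delta>}"
    "measure M' {\<omega> \<in> space M'. W \<omega> \<le> t} \<le> L" "L \<le> measure M' {\<omega> \<in> space M'. W \<omega> \<le> t + 4 * \<delta>}"
proof -
  interpret M: prob_space M by fact
  interpret M': prob_space M' by fact
  have [measurable]: "D n \<in> borel_measurable M" for n
    unfolding D_def[abs_def] by measurable
  obtain R1 where R1: "\<forall>\<^sub>F \<rho> in at_right 0. \<forall>x\<in>E. \<forall>y\<in>E. (2 * a - norm (x - y)) / \<rho>\<^sup>2 \<le> t \<longrightarrow>
      (\<exists>u\<in>cball 0 R1. \<exists>v\<in>cball 0 R1. {x, y} = {cap_chart a (- 1) \<rho> u, cap_chart a 1 \<rho> v})"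
    using far by blast
  obtain R2 where R2: "AE \<omega> in M'. \<forall>i j. pair_value a (X i \<omega>) (Y j \<omega>) \<le> t \<longrightarrow> X i \<omega> \<in> cball 0 R2 \<and> Y j \<omega> \<in> cball 0 R2"
    using window by blast
  \<comment> \<open>Large enough for the window of the sample and for that of the limit, both at
    level t.\<close>
  define R where "R = max R1 R2"
  let ?S = "cball (0 :: real \<times> (real^'n)) (R + 1)"
  obtain \<epsilon> where \<epsilon>: "0 < \<epsilon>" "\<epsilon> \<le> 1"
    and unif: "\<And>x y c c'. x \<in> ?S \<Longrightarrow> y \<in> ?S \<Longrightarrow> c \<in> ?S \<Longrightarrow> c' \<in> ?S \<Longrightarrow>
      dist x c < \<epsilon> \<Longrightarrow> dist y c' < \<epsilon> \<Longrightarrow> \<bar>pair_value a x y - pair_value a c c'\<bar> < \<delta>"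
    using pair_value_uniformly_close[OF \<delta>, of "R + 1" a] by metis
  obtain C where C: "C \<subseteq> cball (0 :: real \<times> (real^'n)) R" "finite C" "cball 0 R \<subseteq> (\<Union>c\<in>C. ball c \<epsilon>)"
  proof (rule compactE_image[of "cball (0 :: real \<times> (real^'n)) R" "cball 0 R" "\<lambda>c. ball c \<epsilon>"])
    show "cball (0 :: real \<times> (real^'n)) R \<subseteq> (\<Union>c\<in>cball 0 R. ball c \<epsilon>)"
      using \<epsilon>(1) by (intro subsetI UN_I) auto
  qed auto
  have cell: "\<exists>c\<in>C. u \<in> ball c \<epsilon>" if "u \<in> cball 0 R" for u using C(3) that by blast
  have near: "\<bar>pair_value a u v - pair_value a c c'\<bar> < \<delta> \<and> u \<in> ?S \<and> v \<in> ?S"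
    if "c \<in> C" "c' \<in> C" "u \<in> ball c \<epsilon>" "v \<in> ball c' \<epsilon>" for u v c c'
  proof -
    have c: "c \<in> ?S" "c' \<in> ?S" "norm c \<le> R" "norm c' \<le> R" using C(1) that by (auto simp: mem_cball_0)
    have d: "dist u c < \<epsilon>" "dist v c' < \<epsilon>" using that by (auto simp: dist_commute)
    have "u \<in> ?S" using c(3) d(1) \<epsilon>(2) norm_triangle_ineq2[of u c] by (auto simp: dist_norm)
    moreover have "v \<in> ?S" using c(4) d(2) \<epsilon>(2) norm_triangle_ineq2[of v c'] by (auto simp: dist_norm)
    ultimately show ?thesis using unif[of u v c c'] c d by blast
  qed
  define I where "I = {-1, 1 :: real} \<times> C"
  define A where "A n = (\<lambda>(\<sigma>, c). {\<omega> \<in> space M. \<exists>i<K n \<omega>. cap_rescale a \<sigma> (\<rho> n) (Z i \<omega>) \<in> ball c \<epsilon>})" for n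
  define B where "B = (\<lambda>(\<sigma>, c). {\<omega> \<in> space M'. \<exists>i. (if \<sigma> = (- 1 :: real) then X i \<omega> else Y i \<omega>) \<in> ball c \<epsilon>})"
  \<comment> \<open>The slack 2\<delta> allows one \<delta> for the chart approximation of the
    deficit and one for moving the points to the centres of their cells. In the converse direction
    the same two errors lead from t + 2\<delta> to t + 4\<delta>.\<close>
  define F :: "(real \<times> real \<times> (real^'n)) set set" where "F = {T. \<exists>c c'. (- 1, c) \<in> T \<and> (1, c') \<in> T \<and> pair_value a c c' \<le> t + 2 * \<delta>}"
  define O1 where "O1 n = {\<omega> \<in> space M. {i \<in> I. \<omega> \<in> A n i} \<in> F}" for n
  define O2 where "O2 = {\<omega> \<in> space M'. {i \<in> I. \<omega> \<in> B i} \<in> F}"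
  have I: "finite I" using C by (simp add: I_def)
  have Am: "A n i \<in> sets M" if "i \<in> I" for n i
    unfolding A_def by (cases i) simp
  have Bm: "B i \<in> sets M'" if "i \<in> I" for i
    unfolding B_def by (cases i) simp
  have O1_iff: "\<omega> \<in> O1 n \<longleftrightarrow> \<omega> \<in> space M \<and> (\<exists>c\<in>C. \<exists>c'\<in>C. \<exists>i<K n \<omega>. \<exists>j<K n \<omega>.
      cap_rescale a (- 1) (\<rho> n) (Z i \<omega>) \<in> ball c \<epsilon> \<and> cap_rescale a 1 (\<rho> n) (Z j \<omega>) \<in> ball c' \<epsilon> \<and>
      pair_value a c c' \<le> t + 2 * \<delta>)" for \<omega> n
    by (simp add: O1_def F_def I_def A_def del: split_paired_Ex mem_ball) blast
  have O2_iff: "\<omega> \<in> O2 \<longleftrightarrow> \<omega> \<in> space M' \<and> (\<exists>c\<in>C. \<exists>c'\<in>C. \<exists>i j. X i \<omega> \<in> ball c \<epsilon> \<and> Y j \<omega> \<in> ball c' \<epsilon> \<and>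
      pair_value a c c' \<le> t + 2 * \<delta>)" for \<omega>
    by (simp add: O2_def F_def I_def B_def del: split_paired_Ex mem_ball) blast
  have O1m [measurable]: "O1 n \<in> sets M" for n
  proof -
    have "O1 n = (\<Union>T\<in>Pow I \<inter> F. {\<omega> \<in> space M. {i \<in> I. \<omega> \<in> A n i} = T})" by (auto simp: O1_def)
    then show ?thesis using I M.occupancy_sets[OF I, of "A n"] Am by auto
  qed
  have O2m [measurable]: "O2 \<in> sets M'"
  proof -
    have "O2 = (\<Union>T\<in>Pow I \<inter> F. {\<omega> \<in> space M'. {i \<in> I. \<omega> \<in> B i} = T})" by (auto simp: O2_def)
    then show ?thesis using I M'.occupancy_sets[OF I, of B] Bm by auto
  qed
  have lim: "(\<lambda>n. measure M (O1 n)) \<longlonglongrightarrow> measure M' O2"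
    unfolding O1_def O2_def
  proof (rule occupancy_convergence[OF M M' I Am Bm])
    fix J assume J: "J \<subseteq> I"
    \<comment> \<open>Avoiding the cells of \<open>J\<close> means that no point lies in
      \<open>Al\<close> in the left chart and none in \<open>Ar\<close> in the right chart.\<close>
    define Al Ar where "Al = (\<Union>c\<in>{c \<in> C. (- 1, c) \<in> J}. ball c \<epsilon>)" and "Ar = (\<Union>c\<in>{c \<in> C. (1, c) \<in> J}. ball c \<epsilon>)"
    have bor: "Al \<in> sets borel" "Ar \<in> sets borel" unfolding Al_def Ar_def by (auto intro!: borel_open)
    have bdd: "bounded Al" "bounded Ar" using C(2) unfolding Al_def Ar_def by auto
    have J_cases: "\<exists>c\<in>C. i = (- 1, c) \<or> i = (1, c)" if "i \<in> J" for i
      using J that by (cases i) (auto simp: I_def)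
    have bex_J: "(\<exists>i\<in>J. P i) \<longleftrightarrow> (\<exists>c\<in>C. (- 1, c) \<in> J \<and> P (- 1, c)) \<or> (\<exists>c\<in>C. (1, c) \<in> J \<and> P (1, c))" for P
      using J_cases by blast
    have "space M - (\<Union>i\<in>J. A n i) = {\<omega> \<in> space M. \<not> (\<exists>i\<in>J. \<omega> \<in> A n i)}" for n by blast
    then have 1: "space M - (\<Union>i\<in>J. A n i) = {\<omega> \<in> space M. \<forall>i<K n \<omega>.
        cap_rescale a (- 1) (\<rho> n) (Z i \<omega>) \<notin> Al \<and> cap_rescale a 1 (\<rho> n) (Z i \<omega>) \<notin> Ar}" for n
      unfolding bex_J by (simp add: A_def Al_def Ar_def del: split_paired_Ex split_paired_All mem_ball) blast
    have "space M' - (\<Union>i\<in>J. B i) = {\<omega> \<in> space M'. \<not> (\<exists>i\<in>J. \<omega> \<in> B i)}" by blast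
    then have 2: "space M' - (\<Union>i\<in>J. B i) = {\<omega> \<in> space M'. (\<forall>i. X i \<omega> \<notin> Al) \<and> (\<forall>i. Y i \<omega> \<notin> Ar)}"
      unfolding bex_J by (simp add: B_def Al_def Ar_def del: split_paired_Ex split_paired_All mem_ball) blast
    show "(\<lambda>n. measure M (space M - (\<Union>i\<in>J. A n i))) \<longlonglongrightarrow> measure M' (space M' - (\<Union>i\<in>J. B i))"
      unfolding 1 2 void'[OF bor(1) bdd(1) bor(2) bdd(2)]
      by (rule cap_void_convergence[OF M a Zm void \<rho> hits bor(1) bdd(1) bor(2) bdd(2)])
  qed
  have at0: "filterlim \<rho> (at_right 0) sequentially"
    using \<rho> by (intro tendsto_imp_filterlim_at_right) auto
  have approx: "\<forall>\<^sub>F n in sequentially. \<forall>u\<in>?S. \<forall>v\<in>?S.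
    \<bar>(2 * a - norm (cap_chart a (- 1) (\<rho> n) u - cap_chart a 1 (\<rho> n) v)) / (\<rho> n)\<^sup>2 - pair_value a u v\<bar> \<le> \<delta>"
    using eventually_compose_filterlim[OF scaled_deficit_approx[OF a \<delta>] at0] .
  have up: "\<forall>\<^sub>F n in sequentially. measure M {\<omega> \<in> space M. D n \<omega> \<le> t} \<le> measure M (O1 n)"
  proof -
    \<comment> \<open>A sample without points has scaled deficit 2a / \<rho>^2, which eventually
      exceeds t; below level t there is thus a pair attaining the maximum.\<close>
    have "(\<lambda>n. (\<rho> n)\<^sup>2 * t) \<longlonglongrightarrow> 0\<^sup>2 * t" by (intro tendsto_intros \<rho>)
    then have "\<forall>\<^sub>F n in sequentially. (\<rho> n)\<^sup>2 * t < 2 * a"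
      by (rule order_tendstoD(2)) (use a in simp)
    with approx eventually_compose_filterlim[OF R1 at0] show ?thesis
    proof eventually_elim
      case (elim n)
      have "AE \<omega> in M. \<forall>i. Z i \<omega> \<in> E" using ZE by (simp add: AE_all_countable)
      then have "AE \<omega> in M. \<omega> \<in> {\<omega> \<in> space M. D n \<omega> \<le> t} \<longrightarrow> \<omega> \<in> O1 n"
      proof eventually_elim
        case ZE: (elim \<omega>)
        show ?case
        proof
          assume \<omega>: "\<omega> \<in> {\<omega> \<in> space M. D n \<omega> \<le> t}"
          then have Dt: "D n \<omega> \<le> t" by simp
          have "K n \<omega> \<noteq> 0"
          proof
            assume "K n \<omega> = 0"
            then have "2 * a / (\<rho> n)\<^sup>2 \<le> t" using Dt by (simp add: D_def max_dist_def)
            then show False using elim(3) \<rho>(1)[of n] by (simp add: divide_le_eq mult.commute)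
          qed
          then have "0 < K n \<omega>" by simp
          from max_dist_attained[OF this, of "\<lambda>i. Z i \<omega>"] obtain i j where ij: "i < K n \<omega>" "j < K n \<omega>"
            and mx: "max_dist (\<lambda>i. Z i \<omega>) (K n \<omega>) = norm (Z i \<omega> - Z j \<omega>)" by blast
          have val: "(2 * a - norm (Z i \<omega> - Z j \<omega>)) / (\<rho> n)\<^sup>2 \<le> t" using Dt mx by (simp add: D_def)
          then obtain u v where uv: "u \<in> cball 0 R1" "v \<in> cball 0 R1"
            and Zuv: "{Z i \<omega>, Z j \<omega>} = {cap_chart a (- 1) (\<rho> n) u, cap_chart a 1 (\<rho> n) v}"
            using elim(2) ZE by blast
          \<comment> \<open>The window statement does not say which of the two points is the left
            one; the indices are swapped if necessary.\<close>
          obtain k l where kl: "k < K n \<omega>" "l < K n \<omega>" "Z k \<omega> = cap_chart a (- 1) (\<rho> n) u" "Z l \<omega> = cap_chart a 1 (\<rho> n) v"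
            and nkl: "norm (Z k \<omega> - Z l \<omega>) = norm (Z i \<omega> - Z j \<omega>)"
            using Zuv ij unfolding doubleton_eq_iff by (metis norm_minus_commute)
          have uvR: "u \<in> cball 0 R" "v \<in> cball 0 R" using uv by (auto simp: R_def)
          obtain c c' where c: "c \<in> C" "c' \<in> C" "u \<in> ball c \<epsilon>" "v \<in> ball c' \<epsilon>"
            using cell uvR by metis
          note n = near[OF c]
          have "\<bar>(2 * a - norm (Z i \<omega> - Z j \<omega>)) / (\<rho> n)\<^sup>2 - pair_value a u v\<bar> \<le> \<delta>"
            using elim(1) n kl(3,4) nkl by metis
          then have "pair_value a c c' \<le> t + 2 * \<delta>" using n val by linarith
          moreover have "cap_rescale a (- 1) (\<rho> n) (Z k \<omega>) = u" "cap_rescale a 1 (\<rho> n) (Z l \<omega>) = v"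
            unfolding kl using \<rho>(1)[of n] by (auto intro!: cap_rescale_chart)
          ultimately show "\<omega> \<in> O1 n" using \<omega> c kl(1,2) unfolding O1_iff by blast
        qed
      qed
      then show ?case by (intro M.finite_measure_mono_AE) auto
    qed
  qed
  have low: "\<forall>\<^sub>F n in sequentially. measure M (O1 n) \<le> measure M {\<omega> \<in> space M. D n \<omega> \<le> t + 4 * \<delta>}"
    using approx
  proof eventually_elim
    case (elim n)
    have "D n \<omega> \<le> t + 4 * \<delta>" if "\<omega> \<in> O1 n" for \<omega>
    proof -
      obtain c c' i j where c: "c \<in> C" "c' \<in> C" and ij: "i < K n \<omega>" "j < K n \<omega>"
        and u: "cap_rescale a (- 1) (\<rho> n) (Z i \<omega>) \<in> ball c \<epsilon>" and v: "cap_rescale a 1 (\<rho> n) (Z j \<omega>) \<in> ball c' \<epsilon>"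
        and g: "pair_value a c c' \<le> t + 2 * \<delta>"
        using \<open>\<omega> \<in> O1 n\<close> unfolding O1_iff by blast
      define x y where "x = cap_rescale a (- 1) (\<rho> n) (Z i \<omega>)" and "y = cap_rescale a 1 (\<rho> n) (Z j \<omega>)"
      have Zij: "Z i \<omega> = cap_chart a (- 1) (\<rho> n) x" "Z j \<omega> = cap_chart a 1 (\<rho> n) y"
        unfolding x_def y_def using \<rho>(1)[of n] by (auto intro!: cap_chart_rescale[symmetric])
      note n = near[OF c u v, folded x_def y_def]
      have "\<bar>(2 * a - norm (Z i \<omega> - Z j \<omega>)) / (\<rho> n)\<^sup>2 - pair_value a x y\<bar> \<le> \<delta>"
        unfolding Zij using elim n by blast
      then have "(2 * a - norm (Z i \<omega> - Z j \<omega>)) / (\<rho> n)\<^sup>2 \<le> t + 4 * \<delta>" using n g by linarith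
      moreover have "D n \<omega> \<le> (2 * a - norm (Z i \<omega> - Z j \<omega>)) / (\<rho> n)\<^sup>2"
        unfolding D_def using max_dist_ge[OF ij, of "\<lambda>i. Z i \<omega>"] by (intro divide_right_mono) auto
      ultimately show ?thesis by linarith
    qed
    then show ?case by (intro M.finite_measure_mono) (auto simp: O1_def)
  qed
  have up': "measure M' {\<omega> \<in> space M'. W \<omega> \<le> t} \<le> measure M' O2"
  proof -
    have "AE \<omega> in M'. \<omega> \<in> {\<omega> \<in> space M'. W \<omega> \<le> t} \<longrightarrow> \<omega> \<in> O2"
      using attained R2
    proof eventually_elim
      case (elim \<omega>)
      show ?case
      proof
        assume \<omega>: "\<omega> \<in> {\<omega> \<in> space M'. W \<omega> \<le> t}"
        obtain i j where "pair_value a (X i \<omega>) (Y j \<omega>) = W \<omega>" using elim(1) by blast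
        then have ij: "pair_value a (X i \<omega>) (Y j \<omega>) \<le> t" using \<omega> by simp
        then have "X i \<omega> \<in> cball 0 R2 \<and> Y j \<omega> \<in> cball 0 R2" using elim(2) by blast
        then have R: "X i \<omega> \<in> cball 0 R" "Y j \<omega> \<in> cball 0 R" by (simp_all add: R_def le_max_iff_disj)
        obtain c c' where c: "c \<in> C" "c' \<in> C" "X i \<omega> \<in> ball c \<epsilon>" "Y j \<omega> \<in> ball c' \<epsilon>"
          using cell R by metis
        have "pair_value a c c' \<le> t + 2 * \<delta>" using near[OF c] ij \<delta> by linarith
        then show "\<omega> \<in> O2" using c \<omega> unfolding O2_iff by blast
      qed
    qed
    then show ?thesis by (intro M'.finite_measure_mono_AE) auto
  qed
  have low': "measure M' O2 \<le> measure M' {\<omega> \<in> space M'. W \<omega> \<le> t + 4 * \<delta>}"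
  proof -
    have "AE \<omega> in M'. \<omega> \<in> O2 \<longrightarrow> \<omega> \<in> {\<omega> \<in> space M'. W \<omega> \<le> t + 4 * \<delta>}"
      using attained
    proof eventually_elim
      case (elim \<omega>)
      show ?case
      proof
        assume "\<omega> \<in> O2"
        then obtain c c' i j where \<omega>: "\<omega> \<in> space M'" and c: "c \<in> C" "c' \<in> C" "X i \<omega> \<in> ball c \<epsilon>" "Y j \<omega> \<in> ball c' \<epsilon>"
          and g: "pair_value a c c' \<le> t + 2 * \<delta>"
          unfolding O2_iff by blast
        have "pair_value a (X i \<omega>) (Y j \<omega>) \<le> t + 4 * \<delta>" using near[OF c] g \<delta> by linarith
        moreover have "W \<omega> \<le> pair_value a (X i \<omega>) (Y j \<omega>)" using elim by blast
        ultimately show "\<omega> \<in> {\<omega> \<in> space M'. W \<omega> \<le> t + 4 * \<delta>}" using \<omega> by simp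
      qed
    qed
    then show ?thesis by (intro M'.finite_measure_mono_AE) auto
  qed
  show thesis by (rule that[OF lim up low up' low'])
qed

text \<open>With G the limiting distribution function, the sandwich at level t gives an asymptotic
  upper bound G (t + \<delta>), and the one at level t - \<delta> an asymptotic lower bound G (t -
  \<delta>). Continuity of G at t closes the gap.\<close>

lemma weak_conv_m_by_sandwich:
  assumes D [measurable]: "\<And>n. D n \<in> borel_measurable M" and W [measurable]: "W \<in> borel_measurable M'"
    and sandwich: "\<And>t \<delta>. \<delta> > 0 \<Longrightarrow> \<exists>b L. b \<longlonglongrightarrow> L \<and>
      (\<forall>\<^sub>F n in sequentially. measure M {\<omega> \<in> space M. D n \<omega> \<le> t} \<le> b n) \<and>
      (\<forall>\<^sub>F n in sequentially. b n \<le> measure M {\<omega> \<in> space M. D n \<omega> \<le> t + \<delta>}) \<and>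
      measure M' {\<omega> \<in> space M'. W \<omega> \<le> t} \<le> L \<and> L \<le> measure M' {\<omega> \<in> space M'. W \<omega> \<le> t + \<delta>}"
  shows "weak_conv_m (\<lambda>n. distr M borel (D n)) (distr M' borel W)"
  unfolding weak_conv_m_def weak_conv_def
proof (intro allI impI)
  fix t assume cont: "isCont (cdf (distr M' borel W)) t"
  define G where "G s = measure M' {\<omega> \<in> space M'. W \<omega> \<le> s}" for s
  have G: "cdf (distr M' borel W) = G" unfolding G_def by (rule ext) (rule cdf_distr_eq[OF W])
  show "(\<lambda>n. cdf (distr M borel (D n)) t) \<longlonglongrightarrow> cdf (distr M' borel W) t"
    unfolding G cdf_distr_eq[OF D]
  proof (rule tendstoI)
    fix e :: real assume e: "e > 0"
    obtain d where d: "d > 0" "\<And>s. dist s t < d \<Longrightarrow> dist (G s) (G t) < e"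
      using cont[unfolded G] e unfolding continuous_at_eps_delta by blast
    define \<delta> where "\<delta> = d / 2"
    have \<delta>: "\<delta> > 0" using d by (simp add: \<delta>_def)
    have up: "G (t + \<delta>) < G t + e" using d(2)[of "t + \<delta>"] d(1) by (simp add: dist_real_def \<delta>_def)
    have low: "G t - e < G (t - \<delta>)" using d(2)[of "t - \<delta>"] d(1) by (simp add: dist_real_def \<delta>_def)
    obtain b L where b: "b \<longlonglongrightarrow> L" "\<forall>\<^sub>F n in sequentially. measure M {\<omega> \<in> space M. D n \<omega> \<le> t} \<le> b n"
      "L \<le> G (t + \<delta>)"
      using sandwich[OF \<delta>, of t] unfolding G_def by blast
    obtain b' L' where b': "b' \<longlonglongrightarrow> L'" "\<forall>\<^sub>F n in sequentially. b' n \<le> measure M {\<omega> \<in> space M. D n \<omega> \<le> t}"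
      "G (t - \<delta>) \<le> L'"
      using sandwich[OF \<delta>, of "t - \<delta>"] unfolding G_def by auto
    have "\<forall>\<^sub>F n in sequentially. b n < G t + e"
      using b up by (intro order_tendstoD(2)[OF b(1)]) simp
    moreover have "\<forall>\<^sub>F n in sequentially. G t - e < b' n"
      using b' low by (intro order_tendstoD(1)[OF b'(1)]) simp
    ultimately show "\<forall>\<^sub>F n in sequentially. dist (measure M {\<omega> \<in> space M. D n \<omega> \<le> t}) (G t) < e"
      using b(2) b'(2) by eventually_elim (simp add: dist_real_def abs_less_iff)
  qed
qed

subsection \<open>The limiting processes\<close>

lemma emeasure_poisson_law_0:
  assumes "m < \<infinity>"
  shows "emeasure (poisson_law m) {0} = ennreal (exp (- enn2real m))"
proof (cases "m = 0")
  case False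
  then have pos: "0 < enn2real m" using assms by (simp add: enn2real_positive_iff less_top zero_less_iff_neq_zero)
  have "emeasure (poisson_law m) {0} = emeasure (measure_pmf (poisson_pmf (enn2real m))) ((of_nat :: nat \<Rightarrow> ennreal) -` {0})"
    using False assms by (simp add: poisson_law_def emeasure_distr)
  also have "(of_nat :: nat \<Rightarrow> ennreal) -` {0} = {0}" by auto
  finally show ?thesis using pos by (simp add: emeasure_pmf_single)
qed (simp add: poisson_law_def)

lemma emeasure_poisson_law_infinity:
  assumes "m < \<infinity>"
  shows "emeasure (poisson_law m) {\<infinity>} = 0"
proof (cases "m = 0")
  case False
  have "(of_nat :: nat \<Rightarrow> ennreal) -` {\<infinity>} = {}" by auto
  then show ?thesis using False assms by (simp add: poisson_law_def emeasure_distr)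
qed (simp add: poisson_law_def)

lemma point_count_eq_0_iff: "point_count X B \<omega> = 0 \<longleftrightarrow> (\<forall>i. X i \<omega> \<notin> B)"
  by (auto simp: point_count_def emeasure_count_space_eq_0)

context prob_space
begin

text \<open>Measurability is read off from the independence clause for a family of one set, because
  \<open>indep_vars\<close> includes it, whereas an equation between laws formed with
  \<open>distr\<close> does not provide it.\<close>

lemma point_count_measurable:
  assumes "poisson_process M \<mu> X" "B \<in> sets \<mu>"
  shows "point_count X B \<in> borel_measurable M"
proof -
  have "indep_vars (\<lambda>_. borel) (\<lambda>i. point_count X B) {..<1 :: nat}"
    using assms(1)[unfolded poisson_process_def, THEN conjunct2, THEN conjunct2, rule_format, of 1 "\<lambda>_. B"] assms(2)
    by (auto simp: disjoint_family_on_def)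
  then show ?thesis by (auto simp: indep_vars_def)
qed

lemma emeasure_point_count:
  assumes pp: "poisson_process M \<mu> X" "B \<in> sets \<mu>" and "{x} \<in> sets borel"
  shows "emeasure M {\<omega> \<in> space M. point_count X B \<omega> = x} = emeasure (poisson_law (emeasure \<mu> B)) {x}"
proof -
  have "poisson_law (emeasure \<mu> B) = distr M borel (point_count X B)"
    using pp by (simp add: poisson_process_def)
  then show ?thesis
    using point_count_measurable[OF pp] assms(3)
    by (simp add: emeasure_distr vimage_def Collect_conj_eq Int_commute)
qed

lemma prob_poisson_process_void:
  assumes pp: "poisson_process M \<mu> X" "B \<in> sets \<mu>" and fin: "emeasure \<mu> B < \<infinity>"
  shows "prob {\<omega> \<in> space M. point_count X B \<omega> = 0} = exp (- measure \<mu> B)"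
  using emeasure_point_count[OF pp, of 0] emeasure_poisson_law_0[OF fin]
  by (simp add: measure_def)

lemma AE_poisson_process_finite:
  assumes pp: "poisson_process M \<mu> X" "B \<in> sets \<mu>" and fin: "emeasure \<mu> B < \<infinity>"
  shows "AE \<omega> in M. finite {i. X i \<omega> \<in> B}"
proof -
  have [measurable]: "point_count X B \<in> borel_measurable M" by (rule point_count_measurable[OF pp])
  have "emeasure M {\<omega> \<in> space M. point_count X B \<omega> = \<infinity>} = 0"
    using emeasure_point_count[OF pp, of \<infinity>] emeasure_poisson_law_infinity[OF fin] by simp
  then have "AE \<omega> in M. point_count X B \<omega> \<noteq> \<infinity>"
    by (subst AE_iff_measurable[OF _ refl]) auto
  then show ?thesis
    by eventually_elim (auto simp: point_count_def emeasure_count_space split: if_splits)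
qed

text \<open>A null set has a Poisson count of mean 0. Applied to the complement of a paraboloid,
  this puts all points inside almost surely, as the deterministic bounds on pairs require.\<close>

lemma AE_poisson_process_in:
  assumes pp: "poisson_process M \<mu> X" "B \<in> sets \<mu>" and null: "emeasure \<mu> B = 0"
  shows "AE \<omega> in M. \<forall>i. X i \<omega> \<notin> B"
proof -
  have [measurable]: "point_count X B \<in> borel_measurable M" by (rule point_count_measurable[OF pp])
  have "prob {\<omega> \<in> space M. point_count X B \<omega> = 0} = 1"
    using prob_poisson_process_void[OF pp] null by (simp add: measure_def)
  then have "AE \<omega> in M. point_count X B \<omega> = 0"
    using AE_prob_1[of "{\<omega> \<in> space M. point_count X B \<omega> = 0}"] by auto
  then show ?thesis by (simp add: point_count_eq_0_iff)
qed

text \<open>Each void event is a cylinder event on a single coordinate of the field of counts, so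
  independence of the two fields factorises the probability into two Poisson void
  probabilities.\<close>

lemma prob_indep_processes_void:
  fixes X Y :: "nat \<Rightarrow> 'a \<Rightarrow> 'b::topological_space"
  assumes X: "poisson_process M \<mu> X" and Y: "poisson_process M \<nu> Y" and ind: "indep_processes M X Y"
    and s: "sets \<mu> = sets borel" "sets \<nu> = sets borel"
    and A: "A \<in> sets borel" "emeasure \<mu> A < \<infinity>" and B: "B \<in> sets borel" "emeasure \<nu> B < \<infinity>"
  shows "prob {\<omega> \<in> space M. (\<forall>i. X i \<omega> \<notin> A) \<and> (\<forall>i. Y i \<omega> \<notin> B)} = exp (- (measure \<mu> A + measure \<nu> B))"
proof -
  let ?P = "Pi\<^sub>M (sets borel) (\<lambda>_. borel) :: ('b set \<Rightarrow> ennreal) measure"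
  have set: "{\<phi> \<in> space ?P. \<phi> C = 0} \<in> sets ?P" if "C \<in> sets borel" for C
  proof -
    have [measurable]: "(\<lambda>\<phi>. \<phi> C) \<in> borel_measurable ?P"
      using that by (rule measurable_component_singleton)
    show ?thesis by measurable
  qed
  have "{\<omega> \<in> space M. (\<forall>i. X i \<omega> \<notin> A) \<and> (\<forall>i. Y i \<omega> \<notin> B)}
    = (\<lambda>\<omega>. ((\<lambda>B\<in>sets borel. point_count X B \<omega>), (\<lambda>B\<in>sets borel. point_count Y B \<omega>))) -`
       ({\<phi> \<in> space ?P. \<phi> A = 0} \<times> {\<phi> \<in> space ?P. \<phi> B = 0}) \<inter> space M"
    using A(1) B(1) by (auto simp: space_PiM point_count_eq_0_iff)
  also have "prob \<dots> = prob ((\<lambda>\<omega>. \<lambda>B\<in>sets borel. point_count X B \<omega>) -` {\<phi> \<in> space ?P. \<phi> A = 0} \<inter> space M) *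
      prob ((\<lambda>\<omega>. \<lambda>B\<in>sets borel. point_count Y B \<omega>) -` {\<phi> \<in> space ?P. \<phi> B = 0} \<inter> space M)"
    by (rule indep_varD[OF ind[unfolded indep_processes_def] set[OF A(1)] set[OF B(1)]])
  also have "(\<lambda>\<omega>. \<lambda>B\<in>sets borel. point_count X B \<omega>) -` {\<phi> \<in> space ?P. \<phi> A = 0} \<inter> space M
      = {\<omega> \<in> space M. point_count X A \<omega> = 0}"
    using A(1) by (auto simp: space_PiM)
  also have "(\<lambda>\<omega>. \<lambda>B\<in>sets borel. point_count Y B \<omega>) -` {\<phi> \<in> space ?P. \<phi> B = 0} \<inter> space M
      = {\<omega> \<in> space M. point_count Y B \<omega> = 0}"
    using B(1) by (auto simp: space_PiM)
  finally show ?thesis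
    using prob_poisson_process_void[OF X] prob_poisson_process_void[OF Y] A B s
    by (simp add: exp_add[symmetric])
qed

end

section \<open>Attainment and measurability of the minimum\<close>

lemma finite_sublevels_attain_min:
  fixes v :: "'i \<Rightarrow> real"
  assumes "\<And>t. finite {k. v k \<le> t}"
  obtains k where "\<And>l. v k \<le> v l"
proof -
  fix k0 :: 'i
  have "\<exists>k. is_arg_min v (\<lambda>k. k \<in> {k. v k \<le> v k0}) k"
    by (rule ex_is_arg_min_if_finite) (use assms[of "v k0"] in auto)
  then obtain k where k: "v k \<le> v k0" "\<And>l. v l \<le> v k0 \<Longrightarrow> \<not> v l < v k"
    by (auto simp: is_arg_min_def)
  have "v k \<le> v l" for l
    using k(1) k(2)[of l] by (cases "v l \<le> v k0") auto
  then show thesis by (rule that)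
qed

text \<open>
  Where the family is unbounded below its infimum is the fixed junk value of \<open>Inf\<close> on the reals, so
  measurability needs no boundedness assumption.
\<close>

lemma borel_measurable_INF_real:
  fixes v :: "'i::countable \<Rightarrow> 'v \<Rightarrow> real"
  assumes [measurable]: "\<And>i. v i \<in> borel_measurable M"
  shows "(\<lambda>\<omega>. INF i. v i \<omega>) \<in> borel_measurable M"
proof -
  \<comment> \<open>Integer bounds keep the quantification countable, so boundedness below is a
    measurable event.\<close>
  define bd where "bd \<omega> \<longleftrightarrow> (\<exists>k::nat. \<forall>i. - real k \<le> v i \<omega>)" for \<omega>
  have [measurable]: "Measurable.pred M bd" unfolding bd_def[abs_def] by measurable
  define w where "w i \<omega> = (if bd \<omega> then v i \<omega> else 0)" for i \<omega>
  have [measurable]: "w i \<in> borel_measurable M" for i unfolding w_def[abs_def] by measurable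
  have "bdd_below (range (\<lambda>i. w i \<omega>))" for \<omega>
  proof (cases "bd \<omega>")
    case True
    then obtain k :: nat where "\<And>i. - real k \<le> v i \<omega>" by (auto simp: bd_def)
    with True show ?thesis by (intro bdd_belowI2[of _ "- real k"]) (simp add: w_def)
  next
    case False
    then show ?thesis by (intro bdd_belowI2[of _ 0]) (simp add: w_def)
  qed
  then have [measurable]: "(\<lambda>\<omega>. INF i. w i \<omega>) \<in> borel_measurable M"
    by (intro borel_measurable_cINF) auto
  \<comment> \<open>The value of \<open>Inf\<close> on every set unbounded below: the least upper
    bound of the negated set is then chosen from an empty predicate, the same for all
    \<omega>.\<close>
  define c :: real where "c = - (LEAST z. False)"
  have "(INF i. v i \<omega>) = (if bd \<omega> then INF i. w i \<omega> else c)" for \<omega>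
  proof (cases "bd \<omega>")
    case False
    have unbounded: "\<not> (\<forall>x\<in>uminus ` range (\<lambda>i. v i \<omega>). x \<le> z)" for z
    proof
      assume z: "\<forall>x\<in>uminus ` range (\<lambda>i. v i \<omega>). x \<le> z"
      obtain k :: nat where "z \<le> real k" using real_arch_simple by blast
      have "- real k \<le> v i \<omega>" for i
      proof -
        have "- v i \<omega> \<le> z" using z by blast
        with \<open>z \<le> real k\<close> show ?thesis by linarith
      qed
      with False show False by (auto simp: bd_def)
    qed
    have "(\<lambda>z. \<forall>x\<in>uminus ` range (\<lambda>i. v i \<omega>). x \<le> z) = (\<lambda>z. False)" by (simp only: unbounded)
    then show ?thesis using False by (simp only: Inf_real_def Sup_real_def c_def if_False)
  qed (simp add: w_def)
  then show ?thesis by simp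
qed

theorem theorem1:
  fixes E :: "(real \<times> (real^'n)) set"
    and a \<eta> pl pr :: real
    and sl sr :: "real^'n \<Rightarrow> real"
    and \<kappa>l \<kappa>r :: "'n \<Rightarrow> real"
    and Hl Hr Ul Ur :: "real^'n^'n"
    and f :: "real \<times> (real^'n) \<Rightarrow> real"
    and M :: "'w measure"
    and Z :: "nat \<Rightarrow> 'w \<Rightarrow> real \<times> (real^'n)"
    and N :: "nat \<Rightarrow> 'w \<Rightarrow> nat"
    and M' :: "'v measure"
    and X Y :: "nat \<Rightarrow> 'v \<Rightarrow> real \<times> (real^'n)"
  assumes "a > 0"
    and "unique_diameter a E"
    and "smooth_pole_caps a E sl sr"
    and "Hl = hessian sl 0" and "Hr = hessian sr 0"
    and "orthonormal_eigenbasis Hl \<kappa>l Ul" and "orthonormal_eigenbasis Hr \<kappa>r Ur"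
    and "\<eta> \<in> {0<..<1}"
    and "positive_semidefinite (curvature_matrix a \<kappa>l Ul \<kappa>r Ur \<eta>)"
    and "\<And>z. z \<in> E \<Longrightarrow> 0 \<le> f z"
    and "(LINT z:E|lborel. f z) = 1"
    and "continuous (at (-a, 0) within E) f" and "continuous (at (a, 0) within E) f"
    and "pl = f (-a, 0)" and "pl > 0"
    and "pr = f (a, 0)" and "pr > 0"
    and "prob_space M"
    and "prob_space.indep_vars M (\<lambda>_. borel) Z UNIV"
    and "\<And>i. distributed M lborel (Z i) (\<lambda>z. ennreal (indicator E z * f z))"
    and "\<And>n. n \<ge> 1 \<Longrightarrow> N n \<in> measurable M (count_space UNIV)"
    and "\<And>n. n \<ge> 1 \<Longrightarrow> distr M (count_space UNIV) (N n) = measure_pmf (poisson_pmf (real n))"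
    and "\<And>n. n \<ge> 1 \<Longrightarrow> prob_space.indep_set M
           (sets (vimage_algebra (space M) (N n) (count_space UNIV)))
           (sets (vimage_algebra (space M) (\<lambda>\<omega> i. Z i \<omega>) (Pi\<^sub>M UNIV (\<lambda>_. borel))))"
    and "prob_space M'"
    and "poisson_process M' (paraboloid_intensity pl Hl) X"
    and "poisson_process M' (paraboloid_intensity pr Hr) Y"
    and "indep_processes M' X Y"
  shows "let d = real DIM(real \<times> (real^'n));
             W = (\<lambda>\<omega>. INF (i, j)\<in>UNIV. pair_value a (X i \<omega>) (Y j \<omega>))
         in (AE \<omega> in M'. \<exists>i j. \<forall>i' j'.
               pair_value a (X i \<omega>) (Y j \<omega>) \<le> pair_value a (X i' \<omega>) (Y j' \<omega>)) \<and>
            weak_conv_m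
              (\<lambda>n. distr M borel (\<lambda>\<omega>. real n powr (2 / (d + 1)) * (2 * a - max_dist (\<lambda>i. Z i \<omega>) (N n \<omega>))))
              (distr M' borel W) \<and>
            weak_conv_m
              (\<lambda>n. distr M borel (\<lambda>\<omega>. real n powr (2 / (d + 1)) * (2 * a - max_dist (\<lambda>i. Z i \<omega>) n)))
              (distr M' borel W)"
proof -
  interpret M: prob_space M by fact
  interpret M': prob_space M' by fact
  let ?\<mu> = "\<lambda>\<sigma>::real. if \<sigma> = - 1 then paraboloid_intensity pl Hl else paraboloid_intensity pr Hr"
  define v where "v \<omega> = (\<lambda>(i, j). pair_value a (X i \<omega>) (Y j \<omega>))" for \<omega>
  define W where "W \<omega> = (INF (i, j)\<in>UNIV. pair_value a (X i \<omega>) (Y j \<omega>))" for \<omega>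
  \<comment> \<open>The exponent is -1/(d+1), as d + 1 = CARD('n) + 2. At n = 0 the power would
    vanish; the value 1 keeps \<rho> positive throughout.\<close>
  define \<rho> :: "nat \<Rightarrow> real" where "\<rho> n = (if n = 0 then 1 else real n powr (- 1 / real (CARD('n) + 2)))" for n
  have a: "a > 0" and \<eta>: "0 < \<eta>" "\<eta> < 1" using assms(1,8) by auto
  have E: "closed E" "(- a, 0) \<in> E" "(a, 0) \<in> E" using assms(2) by (auto simp: unique_diameter_def)
  have capl: "pole_cap a E (- 1) sl" and capr: "pole_cap a E 1 sr"
    using smooth_pole_caps_pole_cap[OF assms(3) E(2,3)] .
  have curv: "(norm (u - w))\<^sup>2 \<le> 2 * a * \<eta> * (u \<bullet> (Hl *v u) + w \<bullet> (Hr *v w))" for u w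
    by (rule curvature_bound[OF assms(6,7,9)])
  have Zd: "distributed M lborel (Z i) (\<lambda>z. ennreal (indicator E z * f z))" for i by (rule assms(20))
  have Zm [measurable]: "Z i \<in> borel_measurable M" for i
    using distributed_measurable[OF Zd] by simp
  have ZE: "AE \<omega> in M. Z i \<omega> \<in> E" for i
  proof -
    have "emeasure M (Z i -` (- E) \<inter> space M) = (\<integral>\<^sup>+z. ennreal (indicator E z * f z) * indicator (- E) z \<partial>lborel)"
      using E(1) by (intro distributed_emeasure[OF Zd]) auto
    also have "\<dots> = (\<integral>\<^sup>+z. 0 \<partial>(lborel :: (real \<times> (real^'n)) measure))"
      by (intro nn_integral_cong) (auto split: split_indicator)
    finally have "Z i -` (- E) \<inter> space M \<in> null_sets M"
      using E(1) by (intro null_setsI) (auto intro!: measurable_sets[OF Zm])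
    then show ?thesis by (rule AE_I') auto
  qed
  have Zid: "distr M borel (Z i) = distr M borel (Z 0)" for i
  proof -
    have "distr M borel (Z i) = distr M lborel (Z i)" for i by (rule distr_cong) auto
    then show ?thesis using distributed_distr_eq_density[OF Zd] by simp
  qed
  have \<rho>0: "\<rho> n > 0" for n by (simp add: \<rho>_def)
  have \<rho>lim: "\<rho> \<longlonglongrightarrow> 0"
  proof -
    have "(\<lambda>n. real n powr (- 1 / real (CARD('n) + 2))) \<longlonglongrightarrow> 0"
      by (rule tendsto_neg_powr[OF _ filterlim_real_sequentially]) simp
    moreover have "\<forall>\<^sub>F n in sequentially. real n powr (- 1 / real (CARD('n) + 2)) = \<rho> n"
      using eventually_gt_at_top[of 0] by eventually_elim (simp add: \<rho>_def)
    ultimately show ?thesis by (rule Lim_transform_eventually)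
  qed
  have \<rho>pow: "real n * \<rho> n ^ (CARD('n) + 2) = 1" if "n \<ge> 1" for n
  proof -
    have "\<rho> n ^ (CARD('n) + 2) = \<rho> n powr real (CARD('n) + 2)"
      using \<rho>0[of n] by (simp only: powr_realpow)
    also have "\<dots> = real n powr (- 1)"
      using that by (simp add: \<rho>_def powr_powr)
    finally show ?thesis using that by (simp add: powr_minus)
  qed
  have hits: "(\<lambda>n. real n * measure M {\<omega> \<in> space M. cap_rescale a \<sigma> (\<rho> n) (Z 0 \<omega>) \<in> A}) \<longlonglongrightarrow> measure (?\<mu> \<sigma>) A"
    if \<sigma>: "\<sigma> \<in> {-1, 1}" and A: "A \<in> sets borel" "bounded A" for \<sigma> A
  proof (cases "\<sigma> = - 1")
    case True
    have "continuous (at (- 1 * a, 0) within E) f" using assms(12) by simp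
    from cap_hit_prob_convergence[OF capl this assms(10) Zd \<rho>0 \<rho>lim \<rho>pow A] show ?thesis
      using True by (simp add: assms(4,14))
  next
    case False
    have "continuous (at (1 * a, 0) within E) f" using assms(13) by simp
    from cap_hit_prob_convergence[OF capr this assms(10) Zd \<rho>0 \<rho>lim \<rho>pow A] show ?thesis
      using False \<sigma> by (simp add: assms(5,16))
  qed
  have far: "\<exists>R. \<forall>\<^sub>F \<rho> in at_right 0. \<forall>x\<in>E. \<forall>y\<in>E. (2 * a - norm (x - y)) / \<rho>\<^sup>2 \<le> t \<longrightarrow>
      (\<exists>u\<in>cball 0 R. \<exists>v\<in>cball 0 R. {x, y} = {cap_chart a (- 1) \<rho> u, cap_chart a 1 \<rho> v})" for t
    using far_pairs_in_window[OF a assms(2) \<eta> capl capr curv[unfolded assms(4,5)], of t] by blast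
  note ppX = assms(25) and ppY = assms(26)
  have sets_int: "sets (paraboloid_intensity p H) = sets borel" for p and H :: "real^'n^'n"
    by (simp add: paraboloid_intensity_def)
  have Xm [measurable]: "X i \<in> borel_measurable M'" for i
  proof -
    have "X i \<in> measurable M' (paraboloid_intensity pl Hl)" using ppX by (simp add: poisson_process_def)
    then show ?thesis by (simp only: measurable_cong_sets[OF refl sets_int])
  qed
  have Ym [measurable]: "Y i \<in> borel_measurable M'" for i
  proof -
    have "Y i \<in> measurable M' (paraboloid_intensity pr Hr)" using ppY by (simp add: poisson_process_def)
    then show ?thesis by (simp only: measurable_cong_sets[OF refl sets_int])
  qed
  have void': "measure M' {\<omega> \<in> space M'. (\<forall>i. X i \<omega> \<notin> A) \<and> (\<forall>i. Y i \<omega> \<notin> B)}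
      = exp (- (measure (?\<mu> (- 1)) A + measure (?\<mu> 1) B))"
    if "A \<in> sets borel" "bounded A" "B \<in> sets borel" "bounded B" for A B
    using M'.prob_indep_processes_void[OF ppX ppY assms(27) sets_int sets_int that(1)
        emeasure_paraboloid_intensity_finite[OF that(2,1)] that(3) emeasure_paraboloid_intensity_finite[OF that(4,3)]]
    by simp
  have null: "emeasure (paraboloid_intensity p H) (- paraboloid H) = 0" for p and H :: "real^'n^'n"
  proof -
    have "emeasure (paraboloid_intensity p H) (- paraboloid H)
      = (\<integral>\<^sup>+x. ennreal p * indicator (paraboloid H) x * indicator (- paraboloid H) x \<partial>lborel)"
      unfolding paraboloid_intensity_def by (subst emeasure_density) (auto intro: borel_comp)
    also have "\<dots> = (\<integral>\<^sup>+x. 0 \<partial>(lborel :: (real \<times> (real^'n)) measure))"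
      by (intro nn_integral_cong) (auto split: split_indicator)
    finally show ?thesis by simp
  qed
  have Xin: "AE \<omega> in M'. \<forall>i. X i \<omega> \<in> paraboloid Hl"
    using M'.AE_poisson_process_in[OF ppX _ null] by (simp add: sets_int borel_comp)
  have Yin: "AE \<omega> in M'. \<forall>i. Y i \<omega> \<in> paraboloid Hr"
    using M'.AE_poisson_process_in[OF ppY _ null] by (simp add: sets_int borel_comp)
  define rad where "rad t = t / (1 - \<eta>) + sqrt (4 * a * \<eta> * (t / (1 - \<eta>)))" for t
  have win: "X i \<omega> \<in> cball 0 (rad t) \<and> Y j \<omega> \<in> cball 0 (rad t)"
    if "\<forall>i. X i \<omega> \<in> paraboloid Hl" "\<forall>i. Y i \<omega> \<in> paraboloid Hr" "pair_value a (X i \<omega>) (Y j \<omega>) \<le> t" for \<omega> i j t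
    using paraboloid_pair_in_window(2)[OF a \<eta> curv _ _ that(3)] that(1,2) by (simp add: rad_def)
  have window: "\<exists>R. AE \<omega> in M'. \<forall>i j. pair_value a (X i \<omega>) (Y j \<omega>) \<le> t \<longrightarrow> X i \<omega> \<in> cball 0 R \<and> Y j \<omega> \<in> cball 0 R" for t
  proof
    show "AE \<omega> in M'. \<forall>i j. pair_value a (X i \<omega>) (Y j \<omega>) \<le> t \<longrightarrow> X i \<omega> \<in> cball 0 (rad t) \<and> Y j \<omega> \<in> cball 0 (rad t)"
      using Xin Yin by eventually_elim (use win in blast)
  qed
  \<comment> \<open>Balls of integer radius form a countable family, so one null set serves all of
    them and the sublevel sets are finite at every real level simultaneously.\<close>
  have finX: "AE \<omega> in M'. \<forall>k::nat. finite {i. X i \<omega> \<in> cball 0 (real k)}"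
    unfolding AE_all_countable
    by (intro allI M'.AE_poisson_process_finite[OF ppX] emeasure_paraboloid_intensity_finite) (auto simp: sets_int)
  have finY: "AE \<omega> in M'. \<forall>k::nat. finite {i. Y i \<omega> \<in> cball 0 (real k)}"
    unfolding AE_all_countable
    by (intro allI M'.AE_poisson_process_finite[OF ppY] emeasure_paraboloid_intensity_finite) (auto simp: sets_int)
  have argmin: "AE \<omega> in M'. \<exists>k. \<forall>l. v \<omega> k \<le> v \<omega> l"
    using Xin Yin finX finY
  proof eventually_elim
    case (elim \<omega>)
    have "finite {k. v \<omega> k \<le> t}" for t
    proof -
      obtain k :: nat where k: "rad t \<le> real k" using real_arch_simple by blast
      have "{k. v \<omega> k \<le> t} \<subseteq> {i. X i \<omega> \<in> cball 0 (real k)} \<times> {j. Y j \<omega> \<in> cball 0 (real k)}"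
      proof
        fix p assume "p \<in> {k. v \<omega> k \<le> t}"
        then obtain i j where p: "p = (i, j)" "pair_value a (X i \<omega>) (Y j \<omega>) \<le> t"
          by (cases p) (auto simp: v_def)
        from win[OF elim(1,2) p(2)] k p(1)
        show "p \<in> {i. X i \<omega> \<in> cball 0 (real k)} \<times> {j. Y j \<omega> \<in> cball 0 (real k)}"
          by auto
      qed
      then show ?thesis using elim(3,4) finite_subset by (metis finite_cartesian_product)
    qed
    from finite_sublevels_attain_min[of "v \<omega>", OF this] show ?case by metis
  qed
  have attained: "AE \<omega> in M'. (\<forall>i j. W \<omega> \<le> pair_value a (X i \<omega>) (Y j \<omega>)) \<and> (\<exists>i j. pair_value a (X i \<omega>) (Y j \<omega>) = W \<omega>)"
    using argmin
  proof eventually_elim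
    case (elim \<omega>)
    then obtain k where k: "\<And>l. v \<omega> k \<le> v \<omega> l" by blast
    have "W \<omega> = v \<omega> k"
      unfolding W_def v_def[symmetric] using k by (intro cInf_eq_minimum) auto
    moreover have "pair_value a (X i \<omega>) (Y j \<omega>) = v \<omega> (i, j)" for i j by (simp add: v_def)
    ultimately show ?case using k by (metis surj_pair)
  qed
  have Wm [measurable]: "W \<in> borel_measurable M'"
  proof -
    have "continuous_on UNIV (\<lambda>p. pair_value a (fst p) (snd p :: real \<times> (real^'n)))"
      unfolding pair_value_def by (intro continuous_intros)
    from measurable_compose[OF borel_measurable_Pair[OF Xm Ym] borel_measurable_continuous_onI[OF this]]
    have "(\<lambda>\<omega>. v \<omega> k) \<in> borel_measurable M'" for k
      unfolding v_def by (cases k) simp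
    then have "(\<lambda>\<omega>. INF k. v \<omega> k) \<in> borel_measurable M'" by (rule borel_measurable_INF_real)
    then show ?thesis by (simp add: W_def[abs_def] v_def)
  qed
  have main: "weak_conv_m (\<lambda>n. distr M borel (\<lambda>\<omega>. (2 * a - max_dist (\<lambda>i. Z i \<omega>) (K n \<omega>)) / (\<rho> n)\<^sup>2)) (distr M' borel W)"
    if Km: "\<And>n. K n \<in> measurable M (count_space UNIV)"
      and void: "\<And>Bs c. (\<And>n. Bs n \<in> sets borel) \<Longrightarrow>
         (\<lambda>n. real n * measure M {\<omega> \<in> space M. Z 0 \<omega> \<in> Bs n}) \<longlonglongrightarrow> c \<Longrightarrow>
         (\<lambda>n. measure M {\<omega> \<in> space M. \<forall>i<K n \<omega>. Z i \<omega> \<notin> Bs n}) \<longlonglongrightarrow> exp (- c)"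
    for K :: "nat \<Rightarrow> 'w \<Rightarrow> nat"
  proof (rule weak_conv_m_by_sandwich[OF _ Wm], goal_cases)
    case (1 n)
    note [measurable] = Km
    show ?case by measurable
  next
    case (2 t \<delta>)
    then have "\<delta> / 4 > 0" by simp
    from occupied_cells_sandwich[where K = K and \<rho> = \<rho> and E = E and W = W and t = t and \<Lambda> = "\<lambda>\<sigma>. measure (?\<mu> \<sigma>)",
        OF assms(18,24) a Zm ZE Km void \<rho>0 \<rho>lim hits far Xm Ym void' Wm attained window this]
    obtain b L where "b \<longlonglongrightarrow> L"
      "\<forall>\<^sub>F n in sequentially. measure M {\<omega> \<in> space M. (2 * a - max_dist (\<lambda>i. Z i \<omega>) (K n \<omega>)) / (\<rho> n)\<^sup>2 \<le> t} \<le> b n"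
      "\<forall>\<^sub>F n in sequentially. b n \<le> measure M {\<omega> \<in> space M. (2 * a - max_dist (\<lambda>i. Z i \<omega>) (K n \<omega>)) / (\<rho> n)\<^sup>2 \<le> t + 4 * (\<delta> / 4)}"
      "measure M' {\<omega> \<in> space M'. W \<omega> \<le> t} \<le> L" "L \<le> measure M' {\<omega> \<in> space M'. W \<omega> \<le> t + 4 * (\<delta> / 4)}" .
    moreover have "4 * (\<delta> / 4) = \<delta>" by simp
    ultimately show ?case by (intro exI[of _ b] exI[of _ L] conjI) (simp_all only:)
  qed
  \<comment> \<open>The two factors differ at n = 0, where the power vanishes while \<rho> is 1;
    \<open>transfer\<close> therefore compares the sequences from n = 1 on.\<close>
  have scale: "x / (\<rho> n)\<^sup>2 = real n powr (2 / (real DIM(real \<times> (real^'n)) + 1)) * x" if "n \<ge> 1" for n x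
  proof -
    have "(\<rho> n)\<^sup>2 = \<rho> n powr 2" using \<rho>0[of n] by simp
    also have "\<dots> = real n powr (- (2 / (2 + real CARD('n))))"
      using that by (simp add: \<rho>_def powr_powr)
    finally show ?thesis by (simp add: powr_minus divide_inverse add_ac)
  qed
  have transfer: "weak_conv_m (\<lambda>n. distr M borel (\<lambda>\<omega>. real n powr (2 / (real DIM(real \<times> (real^'n)) + 1)) * (2 * a - max_dist (\<lambda>i. Z i \<omega>) (K n \<omega>)))) (distr M' borel W)"
    if c: "weak_conv_m (\<lambda>n. distr M borel (\<lambda>\<omega>. (2 * a - max_dist (\<lambda>i. Z i \<omega>) (K' n \<omega>)) / (\<rho> n)\<^sup>2)) (distr M' borel W)"
      and K: "\<And>n. n \<ge> 1 \<Longrightarrow> K' n = K n" for K K' :: "nat \<Rightarrow> 'w \<Rightarrow> nat"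
    unfolding weak_conv_m_def weak_conv_def
  proof (intro allI impI)
    fix t assume "isCont (cdf (distr M' borel W)) t"
    with c have "(\<lambda>n. cdf (distr M borel (\<lambda>\<omega>. (2 * a - max_dist (\<lambda>i. Z i \<omega>) (K' n \<omega>)) / (\<rho> n)\<^sup>2)) t)
        \<longlonglongrightarrow> cdf (distr M' borel W) t"
      unfolding weak_conv_m_def weak_conv_def by blast
    then show "(\<lambda>n. cdf (distr M borel (\<lambda>\<omega>. real n powr (2 / (real DIM(real \<times> (real^'n)) + 1)) * (2 * a - max_dist (\<lambda>i. Z i \<omega>) (K n \<omega>)))) t)
        \<longlonglongrightarrow> cdf (distr M' borel W) t"
      by (rule Lim_transform_eventually[OF _ eventually_mono[OF eventually_ge_at_top[of 1]]]) (simp only: scale K)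
  qed
  \<comment> \<open>Nothing is assumed about \<open>N 0\<close>; putting 0 in its place makes every
    sample size measurable and leaves the limit unchanged.\<close>
  define N' where "N' n = (if n = 0 then (\<lambda>_. 0) else N n)" for n :: nat
  have conv1: "weak_conv_m (\<lambda>n. distr M borel (\<lambda>\<omega>. (2 * a - max_dist (\<lambda>i. Z i \<omega>) (N' n \<omega>)) / (\<rho> n)\<^sup>2)) (distr M' borel W)"
  proof (rule main)
    show "N' n \<in> measurable M (count_space UNIV)" for n
      using assms(21)[of n] by (simp add: N'_def)
    fix Bs c assume Bs: "\<And>n. Bs n \<in> sets borel"
      and lim: "(\<lambda>n. real n * measure M {\<omega> \<in> space M. Z 0 \<omega> \<in> Bs n}) \<longlonglongrightarrow> c"
    \<comment> \<open>For a Poisson size the avoidance probability equals this exponential exactly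
      when n \<ge> 1, so continuity of exp suffices.\<close>
    have "(\<lambda>n. exp (- (real n * measure M {\<omega> \<in> space M. Z 0 \<omega> \<in> Bs n}))) \<longlonglongrightarrow> exp (- c)"
      by (intro tendsto_intros lim)
    moreover have "\<forall>\<^sub>F n in sequentially. exp (- (real n * measure M {\<omega> \<in> space M. Z 0 \<omega> \<in> Bs n}))
        = measure M {\<omega> \<in> space M. \<forall>i<N' n \<omega>. Z i \<omega> \<notin> Bs n}"
      using eventually_ge_at_top[of 1]
    proof eventually_elim
      case (elim n)
      then have "N' n = N n" "real n > 0" by (auto simp: N'_def)
      with M.prob_poisson_avoid[OF assms(19) Zid assms(21)[OF elim] assms(22)[OF elim] _ assms(23)[OF elim] Bs, of n]
      show ?case by simp
    qed
    ultimately show "(\<lambda>n. measure M {\<omega> \<in> space M. \<forall>i<N' n \<omega>. Z i \<omega> \<notin> Bs n}) \<longlonglongrightarrow> exp (- c)"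
      by (rule Lim_transform_eventually)
  qed
  have conv2: "weak_conv_m (\<lambda>n. distr M borel (\<lambda>\<omega>. (2 * a - max_dist (\<lambda>i. Z i \<omega>) n) / (\<rho> n)\<^sup>2)) (distr M' borel W)"
  proof (rule main[of "\<lambda>n _. n"])
    fix Bs c assume Bs: "\<And>n. Bs n \<in> sets borel"
      and lim: "(\<lambda>n. real n * measure M {\<omega> \<in> space M. Z 0 \<omega> \<in> Bs n}) \<longlonglongrightarrow> c"
    show "(\<lambda>n. measure M {\<omega> \<in> space M. \<forall>i<n. Z i \<omega> \<notin> Bs n}) \<longlonglongrightarrow> exp (- c)"
      unfolding M.prob_iid_avoid[OF assms(19) Zid Bs] by (rule tendsto_one_minus_power_exp[OF lim]) simp
  qed simp
  have "AE \<omega> in M'. \<exists>i j. \<forall>i' j'. pair_value a (X i \<omega>) (Y j \<omega>) \<le> pair_value a (X i' \<omega>) (Y j' \<omega>)"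
    using argmin by eventually_elim (auto simp: v_def)
  moreover note transfer[OF conv1, of N] transfer[OF conv2, of "\<lambda>n _. n"]
  ultimately show ?thesis
    unfolding Let_def W_def[abs_def, symmetric] by (simp add: N'_def)
qed

end
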